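(* Let $(X,\mathsf d)$ be a complete separable metric space and let $\mathfrak m$ be a nonnegative Borel measure on $X$, finite on bounded sets, with $\operatorname{supp}\mathfrak m=X$. Let $\sigma,\ \eta=f\mathfrak m,\ \eta_n=f_n\mathfrak m\in\mathscr P_2(X)$ ($n\in\mathbb N$) satisfy: (a) $\sigma$ has compact support; (b) $f_n\to f$ $\mathfrak m$-a.e. in $X$ and, for some $x_0\in X$, the function $x\mapsto\sup_nf_n(x)\,(1+\mathsf d^2(x,x_0))$ belongs to $L^1(X,\mathfrak m)$. Suppose that there exist $C>0$ and Kantorovich potentials $\varphi_n=\psi_n^c$ relative to $(\eta_n,\sigma)$ satisfying $$|\varphi_n(x)|\le C(1+\mathsf d^2(x,x_0))\quad\forall x\in X,$$ $$\psi_n\equiv-\infty\ \text{on }X\setminus\operatorname{supp}\sigma\quad\text{and}\quad\psi_n(x)\le C\ \ \forall x\in X.$$ Then there exist a subsequence $n(k)$ and a Kantorovich potential $\varphi=\psi^c$ relative to $(\eta,\sigma)$ such that $\varphi_{n(k)}\to\varphi$ pointwise in $X$. In addition $|\varphi(x)|\le C(1+\mathsf d^2(x,x_0))$ for all $x\in X$, and $\psi\le C$.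
   Context: $\mathscr P_2(X)$ is the space of Borel probability measures with finite second moment and $W_2$ is the quadratic optimal transport distance (cost $\mathsf d^2$). The $c$-transform of $\psi:X\to\mathbb R\cup\{-\infty\}$ is $\psi^c(x)=\inf_{y\in X}\big\{\frac12\mathsf d^2(x,y)-\psi(y)\big\}$. Kantorovich potential: $\varphi:X\to\mathbb R\cup\{-\infty\}$ is a Kantorovich potential relative to $(\mu,\nu)$, $\mu,\nu\in\mathscr P_2(X)$, if (i) there is a Borel $\psi:X\to\mathbb R\cup\{-\infty\}$ with $\psi\in L^1(X,\nu)$ and $\varphi=\psi^c$; (ii) $\varphi\in L^1(X,\mu)$ and $(\varphi,\psi)$ is a maximizer in Kantorovich's duality $\frac12W_2^2(\mu,\nu)=\sup\{\int\varphi\,d\mu+\int\psi\,d\nu:\ \varphi(x)+\psi(y)\le\frac12\mathsf d^2(x,y)\}$, the supremum being over $\varphi\in L^1(X,\mu)$, $\psi\in L^1(X,\nu)$. Writing "a Kantorovich potential $\varphi=\psi^c$" means that $\psi$ is as in (i), (ii). *)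

theory Defs
  imports "HOL-Probability.Probability"
begin

definition measure_support :: "'a::topological_space measure \<Rightarrow> 'a set" where
  "measure_support \<mu> = {x. \<forall>U. open U \<and> x \<in> U \<longrightarrow> 0 < emeasure \<mu> U}"

definition P2 :: "'a::metric_space measure set" where
  "P2 = {\<mu>. sets \<mu> = sets borel \<and> prob_space \<mu> \<and>
             (\<exists>x\<^sub>0. (\<integral>\<^sup>+x. ennreal ((dist x x\<^sub>0)\<^sup>2) \<partial>\<mu>) < \<infinity>)}"

definition couplings :: "'a measure \<Rightarrow> 'b measure \<Rightarrow> ('a \<times> 'b) measure set" where
  "couplings \<mu> \<nu> = {\<gamma>. sets \<gamma> = sets (\<mu> \<Otimes>\<^sub>M \<nu>) \<and> distr \<gamma> \<mu> fst = \<mu> \<and> distr \<gamma> \<nu> snd = \<nu>}"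

text \<open>The infimum is finite for \<open>\<mu>, \<nu> \<in> P2\<close>, since the product coupling has finite cost; the
  conversion to a real number loses nothing in that case.\<close>

definition W2 :: "'a::metric_space measure \<Rightarrow> 'a measure \<Rightarrow> real" where
  "W2 \<mu> \<nu> = sqrt (enn2real
     (INF \<gamma>\<in>couplings \<mu> \<nu>. \<integral>\<^sup>+p. ennreal ((dist (fst p) (snd p))\<^sup>2) \<partial>\<gamma>))"

text \<open>Functions with values in \<open>\<real> \<union> {-\<infinity>}\<close> are \<^typ>\<open>ereal\<close>-valued functions that avoid \<open>\<infinity>\<close>.
  For such functions the differences and sums below never take the form \<open>\<infinity> - \<infinity>\<close>, and
  \<open>d\<^sup>2/2 - (-\<infinity>) = \<infinity>\<close>.\<close>

definition c_transform :: "('a::metric_space \<Rightarrow> ereal) \<Rightarrow> 'a \<Rightarrow> ereal" where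
  "c_transform \<psi> x = (INF y. ereal ((dist x y)\<^sup>2 / 2) - \<psi> y)"

definition L1 :: "'a measure \<Rightarrow> ('a \<Rightarrow> ereal) set" where
  "L1 \<mu> = {g. g \<in> borel_measurable \<mu> \<and> (\<integral>\<^sup>+x. e2ennreal \<bar>g x\<bar> \<partial>\<mu>) < \<infinity>}"

definition dual_pairs ::
  "'a::metric_space measure \<Rightarrow> 'a measure \<Rightarrow> (('a \<Rightarrow> ereal) \<times> ('a \<Rightarrow> ereal)) set" where
  "dual_pairs \<mu> \<nu> = {(\<phi>, \<psi>). \<phi> \<in> L1 \<mu> \<and> \<psi> \<in> L1 \<nu> \<and> (\<forall>x. \<phi> x \<noteq> \<infinity>) \<and> (\<forall>y. \<psi> y \<noteq> \<infinity>) \<and>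
     (\<forall>x y. \<phi> x + \<psi> y \<le> ereal ((dist x y)\<^sup>2 / 2))}"

text \<open>Members of \<^const>\<open>L1\<close> are finite almost everywhere, so \<^const>\<open>real_of_ereal\<close>
  alters them on a null set only.\<close>

definition dual_value ::
  "'a measure \<Rightarrow> 'a measure \<Rightarrow> ('a \<Rightarrow> ereal) \<times> ('a \<Rightarrow> ereal) \<Rightarrow> real" where
  "dual_value \<mu> \<nu> p =
     (\<integral>x. real_of_ereal (fst p x) \<partial>\<mu>) + (\<integral>y. real_of_ereal (snd p y) \<partial>\<nu>)"

definition dual_maximizer ::
  "'a::metric_space measure \<Rightarrow> 'a measure \<Rightarrow> ('a \<Rightarrow> ereal) \<Rightarrow> ('a \<Rightarrow> ereal) \<Rightarrow> bool" where
  "dual_maximizer \<mu> \<nu> \<phi> \<psi> \<longleftrightarrow>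
     (\<phi>, \<psi>) \<in> dual_pairs \<mu> \<nu> \<and>
     ereal (dual_value \<mu> \<nu> (\<phi>, \<psi>)) = (SUP p\<in>dual_pairs \<mu> \<nu>. ereal (dual_value \<mu> \<nu> p)) \<and>
     ereal (1 / 2 * (W2 \<mu> \<nu>)\<^sup>2) = (SUP p\<in>dual_pairs \<mu> \<nu>. ereal (dual_value \<mu> \<nu> p))"

text \<open>\<open>kantorovich_potential \<mu> \<nu> \<phi> \<psi>\<close>: \<open>\<phi>\<close> is a Kantorovich potential relative to \<open>(\<mu>, \<nu>)\<close>,
  and \<open>\<psi>\<close> witnesses this.\<close>

definition kantorovich_potential ::
  "'a::metric_space measure \<Rightarrow> 'a measure \<Rightarrow> ('a \<Rightarrow> ereal) \<Rightarrow> ('a \<Rightarrow> ereal) \<Rightarrow> bool" where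
  "kantorovich_potential \<mu> \<nu> \<phi> \<psi> \<longleftrightarrow>
     \<mu> \<in> P2 \<and> \<nu> \<in> P2 \<and> (\<forall>x. \<phi> x \<noteq> \<infinity>) \<and>
     (\<forall>y. \<psi> y \<noteq> \<infinity>) \<and> \<psi> \<in> borel_measurable borel \<and> \<psi> \<in> L1 \<nu> \<and> \<phi> = c_transform \<psi> \<and>
     \<phi> \<in> L1 \<mu> \<and> dual_maximizer \<mu> \<nu> \<phi> \<psi>"

end

theory Submission
  imports Defs "HOL-Complex_Analysis.Great_Picard"
begin

text \<open>
  As \<open>\<psi>\<^sub>n\<close> lives on the compact set \<open>K = supp \<sigma>\<close>, the functions \<open>\<phi>\<^sub>n\<close> are Lipschitz on bounded sets,
  uniformly in \<open>n\<close>, so a subsequence converges pointwise to some \<open>q\<close>. Accumulation points of near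
  minimizers of \<open>d\<^sup>2(x,\<cdot>)/2 - \<psi>\<^sub>n\<close> in \<open>K\<close> show that \<open>q = \<psi>\<^sup>c\<close> for \<open>\<psi> = min C q\<^sup>c\<close> on \<open>K\<close>,
  \<open>\<psi> = -\<infinity>\<close> elsewhere, and \<open>limsup \<psi>\<^sub>n \<le> \<psi>\<close> on \<open>K\<close>. By dominated convergence for \<open>\<integral>\<phi>\<^sub>n d\<eta>\<^sub>n\<close>
  and Fatou's lemma for \<open>C - \<psi>\<^sub>n\<close>, the dual value of \<open>(q, \<psi>)\<close> is at least the upper limit of
  \<open>W\<^sub>2\<^sup>2(\<eta>\<^sub>n, \<sigma>)/2\<close>; since \<open>W\<^sub>2\<^sup>2 \<ge> 0\<close> this also gives \<open>\<psi> \<in> L\<^sup>1(\<sigma>)\<close>.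

  By weak duality it remains to see that \<open>W\<^sub>2\<^sup>2(\<eta>, \<sigma>)\<close> is at most the lower limit of
  \<open>W\<^sub>2\<^sup>2(\<eta>\<^sub>n, \<sigma>)\<close>. This needs neither tightness nor gluing of plans: a coupling of \<open>f\<^sub>n m\<close> and \<open>\<sigma>\<close> is
  turned into one of \<open>f m\<close> and \<open>\<sigma>\<close> by keeping the part of it over \<open>min f f\<^sub>n\<close> and transporting the
  excess \<open>(f - f\<^sub>n)\<^sup>+ m\<close> to the rest of \<open>\<sigma>\<close> by a multiple of the product measure, at a cost which tends
  to zero by dominated convergence.
\<close>

subsection \<open>Sums of measures and perturbation of couplings\<close>

text \<open>Serves to assemble a plan from two pieces. The sigma-algebra is that of
  \<open>M\<close>, hence the assumption \<open>sets N = sets M\<close> in the facts on values and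
  integrals.\<close>

definition add_measure :: "'a measure \<Rightarrow> 'a measure \<Rightarrow> 'a measure" where
  "add_measure M N = measure_of (space M) (sets M) (\<lambda>A. emeasure M A + emeasure N A)"

lemma sets_add_measure [simp, measurable_cong]: "sets (add_measure M N) = sets M"
  by (simp add: add_measure_def)

lemma space_add_measure [simp]: "space (add_measure M N) = space M"
  by (simp add: add_measure_def)

lemma emeasure_add_measure:
  assumes "sets N = sets M" "A \<in> sets M"
  shows "emeasure (add_measure M N) A = emeasure M A + emeasure N A"
proof -
  have "countably_additive (sets M) (\<lambda>A. emeasure M A + emeasure N A)"
    unfolding countably_additive_def
    using assms(1) by (auto simp: suminf_add[symmetric] suminf_emeasure)
  moreover have "positive (sets M) (\<lambda>A. emeasure M A + emeasure N A)"
    by (simp add: positive_def)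
  ultimately show ?thesis
    unfolding add_measure_def using assms(2)
    by (intro emeasure_measure_of_sigma) (auto simp: sets.sigma_algebra_axioms)
qed

lemma nn_integral_add_measure:
  assumes N: "sets N = sets M" and f: "f \<in> borel_measurable M"
  shows "(\<integral>\<^sup>+x. f x \<partial>add_measure M N) = (\<integral>\<^sup>+x. f x \<partial>M) + (\<integral>\<^sup>+x. f x \<partial>N)"
  using f
proof (induction rule: borel_measurable_induct)
  case (cong f g)
  moreover have "space N = space M"
    using N by (rule sets_eq_imp_space_eq)
  ultimately show ?case
    by (simp cong: nn_integral_cong_simp)
next
  case (set A)
  then show ?case
    using N by (simp add: emeasure_add_measure)
next
  case (mult u c)
  note [measurable] = mult(2) and [measurable_cong] = N
  show ?case
    using mult by (simp add: nn_integral_cmult distrib_left)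
next
  case (add u v)
  note [measurable] = add(1,4) and [measurable_cong] = N
  show ?case
    using add by (simp add: nn_integral_add algebra_simps)
next
  case (seq U)
  note [measurable] = seq(1) and [measurable_cong] = N
  \<comment> \<open>Both sequences of integrals increase, so the supremum of the sums splits into
    the sum of the suprema.\<close>
  have "incseq (\<lambda>i. \<integral>\<^sup>+x. U i x \<partial>M)" "incseq (\<lambda>i. \<integral>\<^sup>+x. U i x \<partial>N)"
    using \<open>incseq U\<close> by (auto simp: incseq_def le_fun_def intro!: nn_integral_mono)
  then show ?case
    using seq by (simp add: nn_integral_monotone_convergence_SUP SUP_apply ennreal_SUP_add image_image)
qed

text \<open>The marginals are prescribed only in sum: each piece carries part of the mass and need
  not be a coupling by itself.\<close>

lemma couplings_add:
  assumes [measurable_cong]: "sets \<gamma> = sets (\<mu> \<Otimes>\<^sub>M \<nu>)" "sets \<gamma>' = sets (\<mu> \<Otimes>\<^sub>M \<nu>)"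
    and fst: "\<And>A. A \<in> sets \<mu> \<Longrightarrow> emeasure (distr \<gamma> \<mu> fst) A + emeasure (distr \<gamma>' \<mu> fst) A = emeasure \<mu> A"
    and snd: "\<And>B. B \<in> sets \<nu> \<Longrightarrow> emeasure (distr \<gamma> \<nu> snd) B + emeasure (distr \<gamma>' \<nu> snd) B = emeasure \<nu> B"
  shows "add_measure \<gamma> \<gamma>' \<in> couplings \<mu> \<nu>"
proof -
  have eq: "sets \<gamma>' = sets \<gamma>" and sp: "space \<gamma>' = space \<gamma>"
    using assms(1,2) sets_eq_imp_space_eq by (metis, metis)
  have meas: "fst -` A \<inter> space \<gamma> \<in> sets \<gamma>" if "A \<in> sets \<mu>" for A
    using measurable_sets[of fst \<gamma> \<mu> A] that by measurable
  have meas': "snd -` A \<inter> space \<gamma> \<in> sets \<gamma>" if "A \<in> sets \<nu>" for A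
    using measurable_sets[of snd \<gamma> \<nu> A] that by measurable
  have "distr (add_measure \<gamma> \<gamma>') \<mu> fst = \<mu>"
  proof (rule measure_eqI)
    fix A assume "A \<in> sets (distr (add_measure \<gamma> \<gamma>') \<mu> fst)"
    then have "A \<in> sets \<mu>" by simp
    then show "emeasure (distr (add_measure \<gamma> \<gamma>') \<mu> fst) A = emeasure \<mu> A"
      using fst[of A] meas by (simp add: emeasure_distr emeasure_add_measure eq sp)
  qed simp
  moreover have "distr (add_measure \<gamma> \<gamma>') \<nu> snd = \<nu>"
  proof (rule measure_eqI)
    fix A assume "A \<in> sets (distr (add_measure \<gamma> \<gamma>') \<nu> snd)"
    then have "A \<in> sets \<nu>" by simp
    then show "emeasure (distr (add_measure \<gamma> \<gamma>') \<nu> snd) A = emeasure \<nu> A"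
      using snd[of A] meas' by (simp add: emeasure_distr emeasure_add_measure eq sp)
  qed simp
  ultimately show ?thesis
    by (simp add: couplings_def assms)
qed

text \<open>With \<open>a\<close> a target and \<open>b\<close> a source density, keeping the
  fraction \<open>min 1 (a / b)\<close> of the source leaves the part common to both. An infinite
  \<open>b\<close> is excluded, since \<open>a / b\<close> would then be 0.\<close>

lemma ennreal_min_one_divide_mult:
  fixes a b :: ennreal
  assumes "b < \<infinity>"
  shows "min 1 (a / b) * b = min b a"
proof (cases "b = 0")
  case False
  then have *: "a / b * b = a"
    using assms by (simp add: ennreal_divide_times ennreal_divide_self)
  show ?thesis
  proof (cases "a / b \<le> 1")
    case True
    moreover from True have "a \<le> b"
      using mult_right_mono[OF True, of b] * by simp
    ultimately show ?thesis
      using * by (simp add: min_def)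
  next
    case False
    moreover from False have "b \<le> a"
      using mult_right_mono[of 1 "a / b" b] * by simp
    ultimately show ?thesis
      by (auto simp: min_def)
  qed
qed simp

text \<open>Splits a target density into the part shared with the source and the excess. Infinite
  values do no harm, as \<open>top - top = top\<close>.\<close>

lemma ennreal_min_add_minus: "min b a + (a - b) = (a::ennreal)"
  by (cases "b \<le> a")
    (auto simp: min_def add_diff_self_ennreal not_le diff_eq_0_iff_ennreal intro: less_le_trans)

text \<open>Undoes the normalization by the total mass \<open>e\<close>. If \<open>e = 0\<close>,
  then \<open>s \<le> e\<close> forces \<open>s = 0\<close>, and the infinite factor
  \<open>inverse e\<close> meets a zero.\<close>

lemma ennreal_inverse_mult_cancel:
  fixes s e :: ennreal
  assumes "s \<le> e" "e < \<infinity>"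
  shows "inverse e * (s * e) = s"
proof (cases "e = 0")
  case False
  then have "inverse e * e = 1"
    using assms(2) by (metis ennreal_divide_self divide_ennreal_def infinity_ennreal_def mult.commute less_top)
  then show ?thesis
    by (metis mult.left_commute mult.right_neutral)
qed (use assms in auto)

text \<open>Without \<open>s \<le> e\<close> only an inequality survives, because for
  \<open>e = 0\<close> the left side collapses to 0.\<close>

lemma ennreal_inverse_mult_le: "e < \<infinity> \<Longrightarrow> inverse e * (s * e) \<le> (s::ennreal)"
proof (cases "e = 0")
  case False
  assume "e < \<infinity>"
  with False have "inverse e * e = 1"
    by (metis ennreal_divide_self divide_ennreal_def infinity_ennreal_def mult.commute less_top)
  then show ?thesis
    by (metis mult.left_commute mult.right_neutral order_refl)
qed auto

text \<open>
  Subtraction on \<^typ>\<open>ennreal\<close> is truncated, so \<open>f x - f' x\<close> is the positive part of the difference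
  wherever both are finite. When the excess mass \<open>e\<close> is zero, \<open>inverse e\<close> is infinite, but then the
  product measure that it scales is the null measure.
\<close>

lemma coupling_perturbation:
  fixes f f' :: "'a \<Rightarrow> ennreal" and c :: "'a \<times> 'b \<Rightarrow> ennreal"
  assumes f[measurable]: "f \<in> borel_measurable M" and f'[measurable]: "f' \<in> borel_measurable M"
    and prob: "prob_space (density M f)" "prob_space (density M f')"
    and \<gamma>: "\<gamma> \<in> couplings (density M f') N"
    and c[measurable]: "c \<in> borel_measurable (M \<Otimes>\<^sub>M N)" and a[measurable]: "a \<in> borel_measurable M"
    and le: "AE y in N. \<forall>x\<in>space M. c (x, y) \<le> a x"
  obtains \<gamma>' where "\<gamma>' \<in> couplings (density M f) N"
    and "(\<integral>\<^sup>+p. c p \<partial>\<gamma>') \<le> (\<integral>\<^sup>+p. c p \<partial>\<gamma>) + (\<integral>\<^sup>+x. a x * (f x - f' x) \<partial>M)"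
proof -
  have sets_dens: "sets (density M f' \<Otimes>\<^sub>M N) = sets (M \<Otimes>\<^sub>M N)" "sets (density M f \<Otimes>\<^sub>M N) = sets (M \<Otimes>\<^sub>M N)"
    by (auto intro: sets_pair_measure_cong)
  have sets_\<gamma>[measurable_cong]: "sets \<gamma> = sets (M \<Otimes>\<^sub>M N)"
    and fst_\<gamma>: "distr \<gamma> (density M f') fst = density M f'" and snd_\<gamma>: "distr \<gamma> N snd = N"
    using \<gamma> sets_dens by (auto simp: couplings_def)
  have space_\<gamma>: "space \<gamma> = space M \<times> space N"
    using sets_eq_imp_space_eq[OF sets_\<gamma>] by (simp add: space_pair_measure)
  \<comment> \<open>\<open>h\<close> is the fraction of the plan kept over \<open>x\<close>, so that
    \<open>f' * h = min f' f\<close> almost everywhere. Its value where \<open>f'\<close> vanishes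
    does not matter: the first marginal of \<open>\<gamma>\<close> has no mass there.\<close>
  define h where "h x = min 1 (f x / f' x)" for x
  have [measurable]: "h \<in> borel_measurable M"
    unfolding h_def by measurable
  have h_le: "h x \<le> 1" for x by (simp add: h_def)
  have int1: "(\<integral>\<^sup>+x. f x \<partial>M) = 1" "(\<integral>\<^sup>+x. f' x \<partial>M) = 1"
    using prob[THEN prob_space.emeasure_space_1] by (simp_all add: emeasure_density cong: nn_integral_cong)
  have fin: "AE x in M. f x < \<infinity>" "AE x in M. f' x < \<infinity>"
    using nn_integral_PInf_AE[OF f] nn_integral_PInf_AE[OF f'] int1 by (simp_all add: less_top)
  have fst_int: "(\<integral>\<^sup>+p. g (fst p) \<partial>\<gamma>) = (\<integral>\<^sup>+x. f' x * g x \<partial>M)" if [measurable]: "g \<in> borel_measurable M" for g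
  proof -
    have "(\<integral>\<^sup>+p. g (fst p) \<partial>\<gamma>) = (\<integral>\<^sup>+x. g x \<partial>distr \<gamma> (density M f') fst)"
      by (subst nn_integral_distr) auto
    then show ?thesis
      by (simp add: fst_\<gamma> nn_integral_density)
  qed
  \<comment> \<open>\<open>\<alpha>\<close> is the mass missing in the first coordinate once the
    kept part is counted, \<open>\<beta>\<close> the second marginal of the discarded part. Both
    turn out to have mass \<open>e\<close>, so a multiple of their product can fill the gap.\<close>
  define \<alpha> where "\<alpha> = density M (\<lambda>x. f x - f' x)"
  define \<beta> where "\<beta> = distr (density \<gamma> (\<lambda>p. 1 - h (fst p))) N snd"
  define e where "e = (\<integral>\<^sup>+x. f x - f' x \<partial>M)"
  have \<alpha>_space: "emeasure \<alpha> (space M) = e"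
    by (simp add: \<alpha>_def e_def emeasure_density cong: nn_integral_cong)
  have e_le: "e \<le> 1"
    unfolding e_def int1(1)[symmetric] by (intro nn_integral_mono) simp
  have e_fin: "e < \<infinity>"
    using e_le by (auto intro: le_less_trans)
  have [simp]: "sets \<alpha> = sets M" "sets \<beta> = sets N" "space \<alpha> = space M" "space \<beta> = space N"
    by (auto simp: \<alpha>_def \<beta>_def)
  have [measurable_cong]: "sets \<alpha> = sets M" "sets \<beta> = sets N" by auto
  have \<beta>_emeasure: "emeasure \<beta> B = (\<integral>\<^sup>+p. (1 - h (fst p)) * indicator B (snd p) \<partial>\<gamma>)" if [measurable]: "B \<in> sets N" for B
  proof -
    have "emeasure \<beta> B = (\<integral>\<^sup>+y. indicator B y \<partial>\<beta>)"
      using that by simp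
    also have "\<dots> = (\<integral>\<^sup>+p. (1 - h (fst p)) * indicator B (snd p) \<partial>\<gamma>)"
      unfolding \<beta>_def by (subst nn_integral_distr; (subst nn_integral_density)?) auto
    finally show ?thesis .
  qed
  have \<beta>_space: "emeasure \<beta> (space N) = e"
  proof -
    have "emeasure \<beta> (space N) = (\<integral>\<^sup>+p. 1 - h (fst p) \<partial>\<gamma>)"
      by (subst \<beta>_emeasure) (auto simp: space_\<gamma> intro!: nn_integral_cong split: split_indicator)
    also have "\<dots> = (\<integral>\<^sup>+x. f' x * (1 - h x) \<partial>M)"
      by (rule fst_int) measurable
    also have "\<dots> = (\<integral>\<^sup>+x. f' x - f x \<partial>M)"
    proof (intro nn_integral_cong_AE, use fin(2) in eventually_elim)
      fix x assume fin: "f' x < \<infinity>"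
      have "f' x * h x = min (f' x) (f x)"
        using ennreal_min_one_divide_mult[OF fin, of "f x"] by (simp add: h_def mult.commute)
      then have "f' x * (1 - h x) = f' x - min (f' x) (f x)"
        using fin by (simp add: ennreal_right_diff_distrib)
      also have "\<dots> = f' x - f x"
        using fin by (auto simp: min_def diff_eq_0_iff_ennreal)
      finally show "f' x * (1 - h x) = f' x - f x" .
    qed
    \<comment> \<open>\<open>f\<close> and \<open>f'\<close> have integral 1 and share the common
      part \<open>t\<close>. Cancelling the finite \<open>t\<close> shows that the positive and
      negative parts of \<open>f - f'\<close> have equal mass.\<close>
    also have "\<dots> = e"
    proof -
      define t where "t = (\<integral>\<^sup>+x. min (f' x) (f x) \<partial>M)"
      have "t \<le> 1"
        unfolding t_def int1(1)[symmetric] by (intro nn_integral_mono) simp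
      then have "t \<noteq> top" by (auto simp: top_unique)
      have "t + (\<integral>\<^sup>+x. f' x - f x \<partial>M) = (\<integral>\<^sup>+x. f' x \<partial>M)"
        unfolding t_def by (subst nn_integral_add[symmetric]) (auto simp: ennreal_min_add_minus min.commute intro!: nn_integral_cong)
      moreover have "t + e = (\<integral>\<^sup>+x. f x \<partial>M)"
        unfolding t_def e_def by (subst nn_integral_add[symmetric]) (auto simp: ennreal_min_add_minus intro!: nn_integral_cong)
      ultimately show ?thesis
        using \<open>t \<noteq> top\<close> int1 by (metis ennreal_add_left_cancel infinity_ennreal_def)
    qed
    finally show ?thesis .
  qed
  interpret \<alpha>: finite_measure \<alpha>
    by standard (use \<alpha>_space e_fin in auto)
  interpret \<beta>: finite_measure \<beta>
    by standard (use \<beta>_space e_fin in auto)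
  define \<gamma>1 where "\<gamma>1 = density \<gamma> (\<lambda>p. h (fst p))"
  \<comment> \<open>Dividing by \<open>e\<close> gives the product the marginals
    \<open>\<alpha>\<close> and \<open>\<beta>\<close>, which complete those of the kept part
    \<open>\<gamma>1\<close>.\<close>
  define \<gamma>2 where "\<gamma>2 = scale_measure (inverse e) (\<alpha> \<Otimes>\<^sub>M \<beta>)"
  have sets_\<gamma>1[measurable_cong]: "sets \<gamma>1 = sets (M \<Otimes>\<^sub>M N)"
    by (simp add: \<gamma>1_def sets_\<gamma>)
  have sets_\<gamma>2[measurable_cong]: "sets \<gamma>2 = sets (M \<Otimes>\<^sub>M N)"
    unfolding \<gamma>2_def by (simp cong: sets_pair_measure_cong)
  have int_\<gamma>1: "(\<integral>\<^sup>+p. g p \<partial>\<gamma>1) = (\<integral>\<^sup>+p. h (fst p) * g p \<partial>\<gamma>)" if [measurable]: "g \<in> borel_measurable (M \<Otimes>\<^sub>M N)" for g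
    unfolding \<gamma>1_def by (subst nn_integral_density) auto
  have int_\<gamma>2: "(\<integral>\<^sup>+p. g p \<partial>\<gamma>2) = inverse e * (\<integral>\<^sup>+x. \<integral>\<^sup>+y. g (x, y) \<partial>\<beta> \<partial>\<alpha>)"
    if [measurable]: "g \<in> borel_measurable (M \<Otimes>\<^sub>M N)" for g
    unfolding \<gamma>2_def by (subst nn_integral_scale_measure) (auto simp: \<beta>.nn_integral_fst)
  have distr_fst: "emeasure (distr \<delta> (density M f) fst) A = (\<integral>\<^sup>+p. indicator A (fst p) \<partial>\<delta>)"
    if [measurable_cong]: "sets \<delta> = sets (M \<Otimes>\<^sub>M N)" and [measurable]: "A \<in> sets M" for \<delta> A
  proof -
    have "emeasure (distr \<delta> (density M f) fst) A = (\<integral>\<^sup>+x. indicator A x \<partial>distr \<delta> (density M f) fst)"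
      by (rule nn_integral_indicator[symmetric]) simp
    also have "\<dots> = (\<integral>\<^sup>+p. indicator A (fst p) \<partial>\<delta>)"
      by (rule nn_integral_distr) measurable
    finally show ?thesis .
  qed
  have distr_snd: "emeasure (distr \<delta> N snd) A = (\<integral>\<^sup>+p. indicator A (snd p) \<partial>\<delta>)"
    if [measurable_cong]: "sets \<delta> = sets (M \<Otimes>\<^sub>M N)" and [measurable]: "A \<in> sets N" for \<delta> A
  proof -
    have "emeasure (distr \<delta> (N) snd) A = (\<integral>\<^sup>+x. indicator A x \<partial>distr \<delta> (N) snd)"
      by (rule nn_integral_indicator[symmetric]) simp
    also have "\<dots> = (\<integral>\<^sup>+p. indicator A (snd p) \<partial>\<delta>)"
      by (rule nn_integral_distr) measurable
    finally show ?thesis .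
  qed
  have "add_measure \<gamma>1 \<gamma>2 \<in> couplings (density M f) N"
  proof (rule couplings_add)
    fix A assume "A \<in> sets (density M f)"
    then have [measurable]: "A \<in> sets M" by simp
    have "emeasure \<alpha> A \<le> e"
      using emeasure_mono[of A "space M" \<alpha>] sets.sets_into_space[of A M] by (simp add: \<alpha>_space)
    have "emeasure (distr \<gamma>2 (density M f) fst) A = inverse e * (\<integral>\<^sup>+x. e * indicator A x \<partial>\<alpha>)"
      by (simp add: distr_fst[OF sets_\<gamma>2] int_\<gamma>2 \<beta>_space mult.commute)
    also have "\<dots> = emeasure \<alpha> A"
      using ennreal_inverse_mult_cancel[OF \<open>emeasure \<alpha> A \<le> e\<close> e_fin]
      by (simp add: nn_integral_cmult mult.commute)
    finally have 2: "emeasure (distr \<gamma>2 (density M f) fst) A = (\<integral>\<^sup>+x. (f x - f' x) * indicator A x \<partial>M)"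
      by (simp add: \<alpha>_def emeasure_density)
    have "emeasure (distr \<gamma>1 (density M f) fst) A = (\<integral>\<^sup>+p. h (fst p) * indicator A (fst p) \<partial>\<gamma>)"
      by (simp add: distr_fst[OF sets_\<gamma>1] int_\<gamma>1)
    also have "\<dots> = (\<integral>\<^sup>+x. f' x * (h x * indicator A x) \<partial>M)"
      by (rule fst_int) measurable
    also have "\<dots> + (\<integral>\<^sup>+x. (f x - f' x) * indicator A x \<partial>M) = (\<integral>\<^sup>+x. f' x * (h x * indicator A x) + (f x - f' x) * indicator A x \<partial>M)"
      by (rule nn_integral_add[symmetric]) measurable
    also have "\<dots> = (\<integral>\<^sup>+x. f x * indicator A x \<partial>M)"
    proof (intro nn_integral_cong_AE, use fin(2) in eventually_elim)
      fix x assume "f' x < \<infinity>"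
      from ennreal_min_one_divide_mult[OF this, of "f x"] ennreal_min_add_minus[of "f' x" "f x"]
      show "f' x * (h x * indicator A x) + (f x - f' x) * indicator A x = f x * indicator A x"
        by (simp add: h_def mult.commute split: split_indicator)
    qed
    finally show "emeasure (distr \<gamma>1 (density M f) fst) A + emeasure (distr \<gamma>2 (density M f) fst) A = emeasure (density M f) A"
      using 2 by (simp add: emeasure_density)
  next
    fix B assume [measurable]: "B \<in> sets N"
    have "emeasure \<beta> B \<le> e"
      using emeasure_mono[of B "space N" \<beta>] sets.sets_into_space[of B N] by (simp add: \<beta>_space)
    have "emeasure (distr \<gamma>2 N snd) B = inverse e * (emeasure \<beta> B * e)"
      by (simp add: distr_snd[OF sets_\<gamma>2] int_\<gamma>2 \<alpha>_space)
    also have "\<dots> = emeasure \<beta> B"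
      using ennreal_inverse_mult_cancel[OF \<open>emeasure \<beta> B \<le> e\<close> e_fin] .
    finally have 2: "emeasure (distr \<gamma>2 N snd) B = (\<integral>\<^sup>+p. (1 - h (fst p)) * indicator B (snd p) \<partial>\<gamma>)"
      by (simp add: \<beta>_emeasure)
    have "emeasure (distr \<gamma>1 N snd) B = (\<integral>\<^sup>+p. h (fst p) * indicator B (snd p) \<partial>\<gamma>)"
      by (simp add: distr_snd[OF sets_\<gamma>1] int_\<gamma>1)
    then have "emeasure (distr \<gamma>1 N snd) B + emeasure (distr \<gamma>2 N snd) B
        = (\<integral>\<^sup>+p. h (fst p) * indicator B (snd p) + (1 - h (fst p)) * indicator B (snd p) \<partial>\<gamma>)"
      unfolding 2 by (subst nn_integral_add) auto
    also have "\<dots> = (\<integral>\<^sup>+p. indicator B (snd p) \<partial>\<gamma>)"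
      using h_le by (intro nn_integral_cong) (auto split: split_indicator)
    also have "\<dots> = emeasure N B"
      using distr_snd[OF sets_\<gamma>, of B] by (simp add: snd_\<gamma>)
    finally show "emeasure (distr \<gamma>1 N snd) B + emeasure (distr \<gamma>2 N snd) B = emeasure N B" .
  qed (simp_all add: sets_\<gamma>1 sets_\<gamma>2 sets_dens)
  moreover have "(\<integral>\<^sup>+p. c p \<partial>add_measure \<gamma>1 \<gamma>2) \<le> (\<integral>\<^sup>+p. c p \<partial>\<gamma>) + (\<integral>\<^sup>+x. a x * (f x - f' x) \<partial>M)"
  proof -
    have "(\<integral>\<^sup>+p. c p \<partial>\<gamma>1) \<le> (\<integral>\<^sup>+p. c p \<partial>\<gamma>)"
      unfolding int_\<gamma>1[OF c] using mult_right_mono[OF h_le, of "c _"] by (intro nn_integral_mono) simp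
    moreover have "(\<integral>\<^sup>+p. c p \<partial>\<gamma>2) \<le> (\<integral>\<^sup>+x. a x * (f x - f' x) \<partial>M)"
    proof -
      \<comment> \<open>The bound on \<open>c\<close> holds only for \<open>N\<close>-almost every
        \<open>y\<close>. It passes to \<open>\<beta>\<close>, which is dominated by the second
        marginal \<open>N\<close> of \<open>\<gamma>\<close>.\<close>
      have "absolutely_continuous N \<beta>"
        unfolding absolutely_continuous_def
      proof
        fix B assume B: "B \<in> null_sets N"
        then have [measurable]: "B \<in> sets N" by auto
        have "emeasure \<beta> B \<le> (\<integral>\<^sup>+p. indicator B (snd p) \<partial>\<gamma>)"
          unfolding \<beta>_emeasure[OF \<open>B \<in> sets N\<close>] by (intro nn_integral_mono) (auto split: split_indicator)
        also have "\<dots> = emeasure N B"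
          using distr_snd[OF sets_\<gamma>, of B] by (simp add: snd_\<gamma>)
        finally show "B \<in> null_sets \<beta>"
          using null_setsD1[OF B] by (intro null_setsI) auto
      qed
      from absolutely_continuous_AE[OF _ this le]
      have le': "AE y in \<beta>. \<forall>x\<in>space M. c (x, y) \<le> a x" by simp
      have "(\<integral>\<^sup>+y. c (x, y) \<partial>\<beta>) \<le> a x * e" if "x \<in> space M" for x
      proof -
        have "(\<integral>\<^sup>+y. c (x, y) \<partial>\<beta>) \<le> (\<integral>\<^sup>+y. a x \<partial>\<beta>)"
          using le' that by (intro nn_integral_mono_AE) auto
        then show ?thesis by (simp add: \<beta>_space)
      qed
      then have "(\<integral>\<^sup>+x. \<integral>\<^sup>+y. c (x, y) \<partial>\<beta> \<partial>\<alpha>) \<le> (\<integral>\<^sup>+x. a x * e \<partial>\<alpha>)"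
        by (intro nn_integral_mono) simp
      also have "\<dots> = (\<integral>\<^sup>+x. a x \<partial>\<alpha>) * e"
        by (rule nn_integral_multc) measurable
      finally have "(\<integral>\<^sup>+p. c p \<partial>\<gamma>2) \<le> inverse e * ((\<integral>\<^sup>+x. a x \<partial>\<alpha>) * e)"
        unfolding int_\<gamma>2[OF c] by (rule mult_left_mono) simp
      also have "\<dots> \<le> (\<integral>\<^sup>+x. a x \<partial>\<alpha>)"
        by (rule ennreal_inverse_mult_le[OF e_fin])
      also have "\<dots> = (\<integral>\<^sup>+x. a x * (f x - f' x) \<partial>M)"
        unfolding \<alpha>_def by (subst nn_integral_density) (auto simp: mult.commute)
      finally show ?thesis .
    qed
    ultimately show ?thesis
      by (subst nn_integral_add_measure) (auto simp: sets_\<gamma>1 sets_\<gamma>2 add_mono)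
  qed
  ultimately show ?thesis by (rule that)
qed

subsection \<open>Weak duality and stability of the transport cost\<close>

lemma pair_measure_in_couplings:
  assumes "prob_space \<mu>" "prob_space \<nu>"
  shows "\<mu> \<Otimes>\<^sub>M \<nu> \<in> couplings \<mu> \<nu>"
proof -
  interpret \<mu>: prob_space \<mu> by fact
  interpret \<nu>: prob_space \<nu> by fact
  interpret pair_sigma_finite \<mu> \<nu> ..
  have "distr (\<mu> \<Otimes>\<^sub>M \<nu>) \<nu> snd = distr (\<nu> \<Otimes>\<^sub>M \<mu>) \<nu> fst"
    by (subst distr_pair_swap, subst distr_distr) (auto simp: comp_def case_prod_beta)
  then show ?thesis
    by (simp add: couplings_def \<mu>.distr_pair_fst \<nu>.distr_pair_fst)
qed

lemma integrable_L1: "g \<in> L1 \<mu> \<Longrightarrow> integrable \<mu> (\<lambda>x. real_of_ereal (g x))"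
proof -
  assume "g \<in> L1 \<mu>"
  then have [measurable]: "g \<in> borel_measurable \<mu>" and "(\<integral>\<^sup>+x. e2ennreal \<bar>g x\<bar> \<partial>\<mu>) < \<infinity>"
    by (auto simp: L1_def)
  moreover have "ennreal (norm (real_of_ereal (g x))) \<le> e2ennreal \<bar>g x\<bar>" for x
    by (cases "g x") auto
  ultimately show ?thesis
    using nn_integral_mono[of \<mu> "\<lambda>x. ennreal (norm (real_of_ereal (g x)))" "\<lambda>x. e2ennreal \<bar>g x\<bar>"]
    by (intro integrableI_bounded borel_measurable_real_of_ereal) auto
qed

lemma AE_finite_L1: "g \<in> L1 \<mu> \<Longrightarrow> AE x in \<mu>. \<bar>g x\<bar> \<noteq> \<infinity>"
proof -
  assume "g \<in> L1 \<mu>"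
  then have [measurable]: "g \<in> borel_measurable \<mu>" and "(\<integral>\<^sup>+x. e2ennreal \<bar>g x\<bar> \<partial>\<mu>) \<noteq> \<infinity>"
    by (auto simp: L1_def)
  from nn_integral_PInf_AE[OF _ this(2)] have "AE x in \<mu>. e2ennreal \<bar>g x\<bar> \<noteq> \<infinity>" by simp
  then show ?thesis by eventually_elim auto
qed

text \<open>Fatou's lemma concerns nonnegative functions. This translates the integral of a function
  bounded above into the nonnegative integral of its gap to the bound.\<close>

lemma nn_integral_const_minus_L1:
  assumes "prob_space \<mu>" "g \<in> L1 \<mu>" and le: "\<And>x. g x \<le> ereal c"
  shows "(\<integral>\<^sup>+x. e2ennreal (ereal c - g x) \<partial>\<mu>) = ennreal (c - (\<integral>x. real_of_ereal (g x) \<partial>\<mu>))"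
    and "(\<integral>x. real_of_ereal (g x) \<partial>\<mu>) \<le> c"
proof -
  interpret prob_space \<mu> by fact
  note int = integrable_L1[OF assms(2)]
  have AE: "AE x in \<mu>. e2ennreal (ereal c - g x) = ennreal (c - real_of_ereal (g x)) \<and> real_of_ereal (g x) \<le> c"
    using AE_finite_L1[OF assms(2)]
  proof eventually_elim
    fix x assume "\<bar>g x\<bar> \<noteq> \<infinity>"
    with le[of x] show "e2ennreal (ereal c - g x) = ennreal (c - real_of_ereal (g x)) \<and> real_of_ereal (g x) \<le> c"
      by (cases "g x") auto
  qed
  then have "(\<integral>\<^sup>+x. e2ennreal (ereal c - g x) \<partial>\<mu>) = (\<integral>\<^sup>+x. ennreal (c - real_of_ereal (g x)) \<partial>\<mu>)"
    by (intro nn_integral_cong_AE) auto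
  also have "\<dots> = ennreal (\<integral>x. c - real_of_ereal (g x) \<partial>\<mu>)"
    using int AE by (intro nn_integral_eq_integral) auto
  also have "(\<integral>x. c - real_of_ereal (g x) \<partial>\<mu>) = c - (\<integral>x. real_of_ereal (g x) \<partial>\<mu>)"
    using int by (simp add: prob_space)
  finally show "(\<integral>\<^sup>+x. e2ennreal (ereal c - g x) \<partial>\<mu>) = ennreal (c - (\<integral>x. real_of_ereal (g x) \<partial>\<mu>))" .
  have "(\<integral>x. real_of_ereal (g x) \<partial>\<mu>) \<le> (\<integral>x. c \<partial>\<mu>)"
    using int AE by (intro integral_mono_AE) auto
  then show "(\<integral>x. real_of_ereal (g x) \<partial>\<mu>) \<le> c"
    by (simp add: prob_space)
qed

text \<open>Pointwise \<open>\<bar>g\<bar> \<le> \<bar>c\<bar> + (c - g)\<close>, with both sides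
  infinite where \<open>g\<close> is \<open>-\<infinity>\<close>; so a finite integral of the gap
  gives integrability.\<close>

lemma L1_bounded_aboveI:
  assumes "finite_measure \<mu>" and [measurable]: "g \<in> borel_measurable \<mu>" and le: "\<And>x. g x \<le> ereal c"
    and fin: "(\<integral>\<^sup>+x. e2ennreal (ereal c - g x) \<partial>\<mu>) < \<infinity>"
  shows "g \<in> L1 \<mu>"
proof -
  interpret finite_measure \<mu> by fact
  have "e2ennreal \<bar>g x\<bar> \<le> ennreal \<bar>c\<bar> + e2ennreal (ereal c - g x)" for x
  proof (cases "g x")
    case (real r)
    have "ennreal \<bar>r\<bar> \<le> ennreal (\<bar>c\<bar> + (c - r))"
      using le[of x] real by (intro ennreal_leI) auto
    then show ?thesis
      using le[of x] real by (simp add: ennreal_plus)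
  qed (use le[of x] in auto)
  then have "(\<integral>\<^sup>+x. e2ennreal \<bar>g x\<bar> \<partial>\<mu>) \<le> (\<integral>\<^sup>+x. ennreal \<bar>c\<bar> + e2ennreal (ereal c - g x) \<partial>\<mu>)"
    by (rule nn_integral_mono)
  also have "\<dots> < \<infinity>"
    using fin by (subst nn_integral_add) (auto simp: emeasure_eq_measure ennreal_mult_less_top less_top)
  finally show ?thesis
    by (simp add: L1_def)
qed

abbreviation transport_cost :: "('a::metric_space \<times> 'a) measure \<Rightarrow> ennreal" where
  "transport_cost \<gamma> \<equiv> \<integral>\<^sup>+p. ennreal ((dist (fst p) (snd p))\<^sup>2) \<partial>\<gamma>"

lemma W2_power2: "(W2 \<mu> \<nu>)\<^sup>2 = enn2real (INF \<gamma>\<in>couplings \<mu> \<nu>. transport_cost \<gamma>)"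
  by (simp add: W2_def)

text \<open>Weak duality: the constraint is integrated against \<open>\<gamma>\<close>, whose
  marginals turn the left side into the dual value. The factor 2 reflects the cost
  \<open>d^2\<close> in place of \<open>d^2/2\<close>; a negative dual value is truncated to 0 by
  \<open>ennreal\<close>.\<close>

lemma dual_value_le_cost:
  fixes \<mu> \<nu> :: "'a::{metric_space, second_countable_topology} measure"
  assumes sets: "sets \<mu> = sets borel" "sets \<nu> = sets borel"
    and p: "p \<in> dual_pairs \<mu> \<nu>" and \<gamma>: "\<gamma> \<in> couplings \<mu> \<nu>"
  shows "ennreal (2 * dual_value \<mu> \<nu> p) \<le> transport_cost \<gamma>"
proof (cases "transport_cost \<gamma> = \<infinity>")
  case False
  obtain \<phi> \<psi> where p_eq: "p = (\<phi>, \<psi>)" by (cases p)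
  have L1: "\<phi> \<in> L1 \<mu>" "\<psi> \<in> L1 \<nu>" and le: "\<And>x y. \<phi> x + \<psi> y \<le> ereal ((dist x y)\<^sup>2 / 2)"
    using p by (auto simp: dual_pairs_def p_eq)
  have sets_\<gamma>: "sets \<gamma> = sets (\<mu> \<Otimes>\<^sub>M \<nu>)" and marg: "distr \<gamma> \<mu> fst = \<mu>" "distr \<gamma> \<nu> snd = \<nu>"
    using \<gamma> by (auto simp: couplings_def)
  have [measurable_cong]: "sets \<gamma> = sets (borel \<Otimes>\<^sub>M borel)"
    using sets_\<gamma> sets by (simp cong: sets_pair_measure_cong)
  note [measurable_cong] = sets
  have meas: "fst \<in> measurable \<gamma> \<mu>" "snd \<in> measurable \<gamma> \<nu>" by measurable
  define u where "u x = real_of_ereal (\<phi> x)" for x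
  define v where "v x = real_of_ereal (\<psi> x)" for x
  have uv: "integrable \<mu> u" "integrable \<nu> v"
    unfolding u_def[abs_def] v_def[abs_def] using L1 by (auto intro: integrable_L1)
  then have [measurable]: "u \<in> borel_measurable \<mu>" "v \<in> borel_measurable \<nu>" by auto
  have int_uv: "integrable \<gamma> (\<lambda>p. u (fst p))" "integrable \<gamma> (\<lambda>p. v (snd p))"
    using uv integrable_distr[OF meas(1), of u] integrable_distr[OF meas(2), of v] by (auto simp: marg)
  have eq_uv: "(\<integral>p. u (fst p) \<partial>\<gamma>) = (\<integral>x. u x \<partial>\<mu>)" "(\<integral>p. v (snd p) \<partial>\<gamma>) = (\<integral>x. v x \<partial>\<nu>)"
    using integral_distr[OF meas(1), of u] integral_distr[OF meas(2), of v] by (auto simp: marg)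
  have int_d: "integrable \<gamma> (\<lambda>p. (dist (fst p) (snd p))\<^sup>2)"
    using False by (intro integrableI_bounded) (auto simp: less_top)
  have "AE p in \<gamma>. \<bar>\<phi> (fst p)\<bar> \<noteq> \<infinity>" "AE p in \<gamma>. \<bar>\<psi> (snd p)\<bar> \<noteq> \<infinity>"
    by (rule AE_distrD[OF meas(1), unfolded marg, OF AE_finite_L1[OF L1(1)]],
        rule AE_distrD[OF meas(2), unfolded marg, OF AE_finite_L1[OF L1(2)]])
  then have "AE p in \<gamma>. 2 * (u (fst p) + v (snd p)) \<le> (dist (fst p) (snd p))\<^sup>2"
  proof eventually_elim
    fix p assume "\<bar>\<phi> (fst p)\<bar> \<noteq> \<infinity>" "\<bar>\<psi> (snd p)\<bar> \<noteq> \<infinity>"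
    with le[of "fst p" "snd p"] show "2 * (u (fst p) + v (snd p)) \<le> (dist (fst p) (snd p))\<^sup>2"
      by (cases "\<phi> (fst p)"; cases "\<psi> (snd p)") (auto simp: u_def v_def)
  qed
  then have "(\<integral>p. 2 * (u (fst p) + v (snd p)) \<partial>\<gamma>) \<le> (\<integral>p. (dist (fst p) (snd p))\<^sup>2 \<partial>\<gamma>)"
    using int_uv int_d by (intro integral_mono_AE) auto
  moreover have "(\<integral>p. 2 * (u (fst p) + v (snd p)) \<partial>\<gamma>) = 2 * dual_value \<mu> \<nu> p"
    using int_uv eq_uv by (simp add: dual_value_def p_eq u_def v_def)
  moreover have "transport_cost \<gamma> = ennreal (\<integral>p. (dist (fst p) (snd p))\<^sup>2 \<partial>\<gamma>)"
    using int_d by (intro nn_integral_eq_integral) auto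
  ultimately show ?thesis
    by (simp add: ennreal_leI)
qed simp

text \<open>By weak duality, one admissible pair reaching \<open>W2^2/2\<close> is a maximizer and
  at the same time closes the duality gap. The infimum must be finite, because
  \<open>enn2real\<close> would turn an infinite one into 0.\<close>

lemma dual_maximizerI:
  fixes \<mu> \<nu> :: "'a::{metric_space, second_countable_topology} measure"
  assumes sets: "sets \<mu> = sets borel" "sets \<nu> = sets borel"
    and p: "(\<phi>, \<psi>) \<in> dual_pairs \<mu> \<nu>"
    and fin: "(INF \<gamma>\<in>couplings \<mu> \<nu>. transport_cost \<gamma>) < \<infinity>"
    and le: "1 / 2 * (W2 \<mu> \<nu>)\<^sup>2 \<le> dual_value \<mu> \<nu> (\<phi>, \<psi>)"
  shows "dual_maximizer \<mu> \<nu> \<phi> \<psi>"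
proof -
  have bound: "dual_value \<mu> \<nu> q \<le> 1 / 2 * (W2 \<mu> \<nu>)\<^sup>2" if "q \<in> dual_pairs \<mu> \<nu>" for q
  proof (cases "dual_value \<mu> \<nu> q \<le> 0")
    case False
    have "ennreal (2 * dual_value \<mu> \<nu> q) \<le> (INF \<gamma>\<in>couplings \<mu> \<nu>. transport_cost \<gamma>)"
      by (intro INF_greatest dual_value_le_cost sets that)
    from enn2real_mono[OF this] fin have "enn2real (ennreal (2 * dual_value \<mu> \<nu> q)) \<le> (W2 \<mu> \<nu>)\<^sup>2"
      unfolding W2_power2 by simp
    with False show ?thesis by simp
  qed (use zero_le_power2[of "W2 \<mu> \<nu>"] in linarith)
  have eq: "dual_value \<mu> \<nu> (\<phi>, \<psi>) = 1 / 2 * (W2 \<mu> \<nu>)\<^sup>2"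
    using bound[OF p] le by simp
  have "(SUP q\<in>dual_pairs \<mu> \<nu>. ereal (dual_value \<mu> \<nu> q)) = ereal (dual_value \<mu> \<nu> (\<phi>, \<psi>))"
  proof (rule antisym)
    show "(SUP q\<in>dual_pairs \<mu> \<nu>. ereal (dual_value \<mu> \<nu> q)) \<le> ereal (dual_value \<mu> \<nu> (\<phi>, \<psi>))"
      using bound unfolding eq by (intro SUP_least) simp
  qed (rule SUP_upper[OF p])
  then show ?thesis
    using p eq by (simp add: dual_maximizer_def)
qed

text \<open>For almost every \<open>y\<close> the cost is controlled by a function of
  \<open>x\<close> alone, so only the first marginal enters the bound, which is therefore uniform
  over all couplings.\<close>

lemma transport_cost_le:
  fixes \<mu> \<nu> :: "'a::{metric_space, second_countable_topology} measure"
  assumes sets: "sets \<mu> = sets borel" "sets \<nu> = sets borel"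
    and [measurable]: "a \<in> borel_measurable borel"
    and le: "AE y in \<nu>. \<forall>x. ennreal ((dist x y)\<^sup>2) \<le> a x" and \<gamma>: "\<gamma> \<in> couplings \<mu> \<nu>"
  shows "transport_cost \<gamma> \<le> (\<integral>\<^sup>+x. a x \<partial>\<mu>)"
proof -
  have sets_\<gamma>: "sets \<gamma> = sets (\<mu> \<Otimes>\<^sub>M \<nu>)" and marg: "distr \<gamma> \<mu> fst = \<mu>" "distr \<gamma> \<nu> snd = \<nu>"
    using \<gamma> by (auto simp: couplings_def)
  note [measurable_cong] = sets_\<gamma> sets
  have meas: "fst \<in> measurable \<gamma> \<mu>" "snd \<in> measurable \<gamma> \<nu>" by measurable
  have "AE p in \<gamma>. \<forall>x. ennreal ((dist x (snd p))\<^sup>2) \<le> a x"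
    by (rule AE_distrD[OF meas(2), unfolded marg, OF le])
  then have "transport_cost \<gamma> \<le> (\<integral>\<^sup>+p. a (fst p) \<partial>\<gamma>)"
    by (intro nn_integral_mono_AE) auto
  also have "\<dots> = (\<integral>\<^sup>+x. a x \<partial>distr \<gamma> \<mu> fst)"
    by (rule nn_integral_distr[symmetric]) measurable
  finally show ?thesis by (simp add: marg)
qed

lemma INF_transport_cost_finite:
  fixes \<mu> \<nu> :: "'a::{metric_space, second_countable_topology} measure"
  assumes sets: "sets \<mu> = sets borel" "sets \<nu> = sets borel" and prob: "prob_space \<mu>" "prob_space \<nu>"
    and a: "a \<in> borel_measurable borel"
    and le: "AE y in \<nu>. \<forall>x. ennreal ((dist x y)\<^sup>2) \<le> a x" and fin: "(\<integral>\<^sup>+x. a x \<partial>\<mu>) < \<infinity>"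
  shows "(INF \<gamma>\<in>couplings \<mu> \<nu>. transport_cost \<gamma>) < \<infinity>"
proof -
  have *: "\<mu> \<Otimes>\<^sub>M \<nu> \<in> couplings \<mu> \<nu>"
    using prob by (rule pair_measure_in_couplings)
  have "(INF \<gamma>\<in>couplings \<mu> \<nu>. transport_cost \<gamma>) \<le> transport_cost (\<mu> \<Otimes>\<^sub>M \<nu>)"
    by (rule INF_lower[OF *])
  also have "\<dots> \<le> (\<integral>\<^sup>+x. a x \<partial>\<mu>)"
    by (rule transport_cost_le[OF sets a le *])
  finally show ?thesis using fin by simp
qed

text \<open>The rerouting cost in \<open>coupling_perturbation\<close> does not depend on the plan,
  so the infimum over plans can be taken. Integrability of \<open>a\<close> against both densities
  makes both infima finite, and \<open>W2\<close> then represents them faithfully.\<close>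

lemma W2_perturbation:
  fixes f f' :: "'a::{metric_space, second_countable_topology} \<Rightarrow> ennreal"
  assumes M: "sets M = sets borel" and N: "sets N = sets borel"
    and f[measurable]: "f \<in> borel_measurable M" and f'[measurable]: "f' \<in> borel_measurable M"
    and prob: "prob_space (density M f)" "prob_space (density M f')" "prob_space N"
    and a[measurable]: "a \<in> borel_measurable borel"
    and le: "AE y in N. \<forall>x. ennreal ((dist x y)\<^sup>2) \<le> a x"
    and fin: "(\<integral>\<^sup>+x. f x * a x \<partial>M) < \<infinity>" "(\<integral>\<^sup>+x. f' x * a x \<partial>M) < \<infinity>"
  shows "ennreal ((W2 (density M f) N)\<^sup>2) \<le> ennreal ((W2 (density M f') N)\<^sup>2) + (\<integral>\<^sup>+x. a x * (f x - f' x) \<partial>M)"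
proof -
  note [measurable_cong] = M N
  have [measurable]: "a \<in> borel_measurable M" by measurable
  define I where "I = (INF \<gamma>\<in>couplings (density M f) N. transport_cost \<gamma>)"
  define I' where "I' = (INF \<gamma>\<in>couplings (density M f') N. transport_cost \<gamma>)"
  define \<delta> where "\<delta> = (\<integral>\<^sup>+x. a x * (f x - f' x) \<partial>M)"
  have "I < \<infinity>"
    unfolding I_def by (rule INF_transport_cost_finite[where a = a])
      (use M N prob le fin in \<open>simp_all add: nn_integral_density\<close>)
  have "I' < \<infinity>"
    unfolding I'_def by (rule INF_transport_cost_finite[where a = a])
      (use M N prob le fin in \<open>simp_all add: nn_integral_density\<close>)
  \<comment> \<open>Moving \<open>\<delta>\<close> to the left leaves a lower bound for the cost
    that is the same for all \<open>\<gamma>\<close>.\<close>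
  have "I - \<delta> \<le> transport_cost \<gamma>" if \<gamma>: "\<gamma> \<in> couplings (density M f') N" for \<gamma>
  proof -
    have "AE y in N. \<forall>x\<in>space M. ennreal ((dist (fst (x, y)) (snd (x, y)))\<^sup>2) \<le> a x"
      using le by eventually_elim simp
    then obtain \<gamma>' where "\<gamma>' \<in> couplings (density M f) N" "transport_cost \<gamma>' \<le> transport_cost \<gamma> + \<delta>"
      unfolding \<delta>_def
      by (rule coupling_perturbation[OF f f' prob(1,2) \<gamma>, rotated 2]) auto
    then have "I \<le> transport_cost \<gamma> + \<delta>"
      unfolding I_def by (rule INF_lower2)
    then show ?thesis
      using \<open>I < \<infinity>\<close> by (auto simp: ennreal_minus_le_iff add.commute)
  qed
  then have "I - \<delta> \<le> I'"
    unfolding I'_def by (rule INF_greatest)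
  then have "I \<le> I' + \<delta>"
    using \<open>I < \<infinity>\<close> by (auto simp: ennreal_minus_le_iff add.commute)
  then show ?thesis
    using \<open>I < \<infinity>\<close> \<open>I' < \<infinity>\<close>
    by (simp add: W2_power2 I_def[symmetric] I'_def[symmetric] \<delta>_def[symmetric])
qed

lemma integral_density_ennreal:
  fixes g :: "'a \<Rightarrow> real"
  assumes [measurable]: "f \<in> borel_measurable M" "g \<in> borel_measurable M" and fin: "AE x in M. f x < \<infinity>"
  shows "(\<integral>x. g x \<partial>density M f) = (\<integral>x. enn2real (f x) * g x \<partial>M)"
proof -
  have "density M f = density M (\<lambda>x. ennreal (enn2real (f x)))"
    using fin by (intro density_cong) (auto elim: eventually_mono)
  then show ?thesis
    by (simp add: integral_density)
qed

subsection \<open>Limits of potentials\<close>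

text \<open>The pointwise half of Arzela-Ascoli: a diagonal subsequence converges on a countable
  dense set, and equicontinuity carries the Cauchy property to every other point by an
  \<open>e / 3\<close> argument.\<close>

lemma equicontinuous_pointwise_subsequence:
  fixes p :: "nat \<Rightarrow> 'a::{metric_space, second_countable_topology} \<Rightarrow> real"
  assumes bound: "\<And>n x. \<bar>p n x\<bar> \<le> b x" and pos: "\<And>x. b x > 0"
    and equi: "\<And>x e. e > 0 \<Longrightarrow> \<exists>d>0. \<forall>n y. dist y x < d \<longrightarrow> \<bar>p n y - p n x\<bar> < e"
  obtains r q where "strict_mono (r :: nat \<Rightarrow> nat)" "\<And>x. (\<lambda>k. p (r k) x) \<longlonglongrightarrow> q x"
proof -
  obtain D :: "'a set" where D: "countable D" "\<And>X. open X \<Longrightarrow> X \<noteq> {} \<Longrightarrow> \<exists>d\<in>D. d \<in> X"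
    using countable_dense_exists by blast
  \<comment> \<open>Dividing by \<open>b\<close> yields one bound for all points, as the diagonal
    argument wants; at a fixed point the factor is multiplied back.\<close>
  have "norm (p n x / b x) \<le> 1" for n x
    using bound[of n x] pos[of x] by simp
  then obtain r where r: "strict_mono (r :: nat \<Rightarrow> nat)" "\<And>x. x \<in> D \<Longrightarrow> \<exists>l. (\<lambda>n. p (r n) x / b x) \<longlonglongrightarrow> l"
    using function_convergent_subsequence[OF D(1), of "\<lambda>n x. p n x / b x" 1] by metis
  have conv: "convergent (\<lambda>n. p (r n) x)" if "x \<in> D" for x
  proof -
    obtain l where "(\<lambda>n. p (r n) x / b x) \<longlonglongrightarrow> l" using r(2)[OF \<open>x \<in> D\<close>] by blast
    from tendsto_mult_right[OF this, of "b x"] pos[of x] show ?thesis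
      by (auto simp: convergent_def)
  qed
  have "convergent (\<lambda>n. p (r n) x)" for x
  proof (rule Cauchy_convergent, rule metric_CauchyI)
    fix e :: real assume "e > 0"
    obtain d where d: "d > 0" "\<And>n y. dist y x < d \<Longrightarrow> \<bar>p n y - p n x\<bar> < e / 3"
      using equi[of "e / 3" x] \<open>e > 0\<close> by auto
    obtain y where y: "y \<in> D" "dist y x < d"
      using D(2)[of "ball x d"] d(1) by (auto simp: dist_commute)
    obtain N where N: "\<And>m n. m \<ge> N \<Longrightarrow> n \<ge> N \<Longrightarrow> dist (p (r m) y) (p (r n) y) < e / 3"
      using metric_CauchyD[OF convergent_Cauchy[OF conv[OF y(1)]], of "e / 3"] \<open>e > 0\<close> by auto
    have "dist (p (r m) x) (p (r n) x) < e" if "m \<ge> N" "n \<ge> N" for m n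
      using N[OF that] d(2)[OF y(2), of "r m"] d(2)[OF y(2), of "r n"] unfolding dist_real_def by linarith
    then show "\<exists>M. \<forall>m\<ge>M. \<forall>n\<ge>M. dist (p (r m) x) (p (r n) x) < e" by blast
  qed
  then show ?thesis
    by (intro that[OF r(1), of "\<lambda>x. lim (\<lambda>n. p (r n) x)"]) (simp add: convergent_LIMSEQ_iff)
qed

text \<open>Only \<open>y\<close> in \<open>K\<close> matter, since elsewhere the term of the
  infimum is infinite. On \<open>K\<close> the difference of squared distances factors: one factor
  is at most \<open>dist x x'\<close>, the other is bounded through the radius \<open>R\<close>. The
  additive form avoids subtracting possibly infinite transforms.\<close>

lemma c_transform_le_add:
  assumes K: "\<And>y. y \<notin> K \<Longrightarrow> \<psi> y = -\<infinity>" "\<And>y. y \<in> K \<Longrightarrow> dist z y \<le> R"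
  shows "c_transform \<psi> x \<le> c_transform \<psi> x' + ereal (dist x x' * (dist x z + dist x' z + 2 * R) / 2)"
    (is "_ \<le> _ + ereal ?L")
proof -
  have "c_transform \<psi> x - ereal ?L \<le> ereal ((dist x' y)\<^sup>2 / 2) - \<psi> y" for y
  proof (cases "y \<in> K")
    case True
    have "dist x y \<le> dist x x' + dist x' y" "dist x y \<le> dist x z + R" "dist x' y \<le> dist x' z + R"
      using dist_triangle[of x y x'] dist_triangle[of x y z] dist_triangle[of x' y z] K(2)[OF True] by auto
    then have "(dist x y - dist x' y) * (dist x y + dist x' y) \<le> dist x x' * (dist x z + dist x' z + 2 * R)"
      by (intro order_trans[OF mult_right_mono mult_left_mono]) auto
    then have "(dist x y)\<^sup>2 / 2 \<le> (dist x' y)\<^sup>2 / 2 + ?L"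
      by (simp add: power2_eq_square field_simps)
    moreover have "c_transform \<psi> x \<le> ereal ((dist x y)\<^sup>2 / 2) - \<psi> y"
      unfolding c_transform_def by (rule INF_lower) simp
    ultimately show ?thesis
      by (cases "\<psi> y"; cases "c_transform \<psi> x") auto
  qed (simp add: K(1))
  then have "c_transform \<psi> x - ereal ?L \<le> c_transform \<psi> x'"
    unfolding c_transform_def[of \<psi> x'] by (rule INF_greatest)
  then show ?thesis
    by (simp add: ereal_minus_le)
qed

text \<open>
  The cutoff at \<open>C\<close> is there because the conjugate of \<open>q\<close> alone need not be bounded by \<open>C\<close> on \<open>K\<close>; it
  does not change the \<open>c\<close>-transform.
\<close>

definition limit_potential :: "'a::metric_space set \<Rightarrow> real \<Rightarrow> ('a \<Rightarrow> real) \<Rightarrow> 'a \<Rightarrow> ereal" where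
  "limit_potential K C q y = (if y \<in> K then min (ereal C) (c_transform (\<lambda>x. ereal (q x)) y) else -\<infinity>)"

text \<open>An infimum of continuous functions, even an uncountable one, is upper semicontinuous:
  its strict sublevel sets are unions of open sets.\<close>

lemma borel_measurable_c_transform:
  "c_transform (\<lambda>x. ereal (q x)) \<in> borel_measurable borel"
proof (rule borel_measurableI_less)
  fix t :: ereal
  have "{y. c_transform (\<lambda>x. ereal (q x)) y < t} = (\<Union>x. {y. ereal ((dist y x)\<^sup>2 / 2 - q x) < t})"
    by (auto simp: c_transform_def INF_less_iff)
  moreover have "open {y. ereal ((dist y x)\<^sup>2 / 2 - q x) < t}" for x
    by (auto intro!: open_Collect_less continuous_intros)
  ultimately show "{y \<in> space borel. c_transform (\<lambda>x. ereal (q x)) y < t} \<in> sets borel"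
    by (simp add: borel_open open_UN)
qed

lemma borel_measurable_limit_potential:
  assumes "closed K"
  shows "limit_potential K C q \<in> borel_measurable borel"
  unfolding limit_potential_def[abs_def]
  by (intro measurable_If_set borel_measurable_min borel_measurable_c_transform) (use assms in auto)

lemma limit_potential_le: "limit_potential K C q y \<le> ereal C"
  by (simp add: limit_potential_def)

lemma limit_potential_le_cost: "limit_potential K C q y \<le> ereal ((dist y x)\<^sup>2 / 2 - q x)"
proof -
  have "c_transform (\<lambda>x. ereal (q x)) y \<le> ereal ((dist y x)\<^sup>2 / 2 - q x)"
    unfolding c_transform_def by (rule INF_lower2[of x]) auto
  then show ?thesis
    by (auto simp: limit_potential_def min_le_iff_disj)
qed

lemma le_limit_potential:
  assumes "y \<in> K" "t \<le> C" "\<And>x. t \<le> (dist y x)\<^sup>2 / 2 - q x"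
  shows "ereal t \<le> limit_potential K C q y"
  using assms unfolding limit_potential_def c_transform_def by (auto intro!: INF_greatest)

lemma le_of_c_transform_eq:
  assumes "c_transform \<psi> x = ereal p" "\<psi> y \<noteq> \<infinity>"
  shows "\<psi> y \<le> ereal ((dist x y)\<^sup>2 / 2 - p)"
proof -
  have "ereal p \<le> ereal ((dist x y)\<^sup>2 / 2) - \<psi> y"
    unfolding assms(1)[symmetric] c_transform_def by (rule INF_lower) simp
  then show ?thesis
    using assms(2) by (cases "\<psi> y") auto
qed

text \<open>For one inequality, near minimizers for \<open>\<psi> n\<close> accumulate at a point of
  \<open>K\<close> where the limit potential is large enough. For the other, the limit potential
  lies below the conjugate of \<open>q\<close>.\<close>

lemma c_transform_limit_potential:
  fixes p :: "nat \<Rightarrow> 'a::metric_space \<Rightarrow> real"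
  assumes lim: "\<And>x. (\<lambda>n. p n x) \<longlonglongrightarrow> q x" and p: "\<And>n x. c_transform (\<psi> n) x = ereal (p n x)"
    and K: "compact K" "\<And>n y. y \<notin> K \<Longrightarrow> \<psi> n y = -\<infinity>" and C: "\<And>n y. \<psi> n y \<le> ereal C"
  shows "c_transform (limit_potential K C q) x = ereal (q x)"
proof (rule antisym)
  \<comment> \<open>The infimum need not be attained, hence the tolerance
    \<open>inverse (real (Suc n))\<close>. A finite upper bound for the term excludes
    \<open>\<psi> n y = -\<infinity>\<close>, which places \<open>y\<close> in
    \<open>K\<close>.\<close>
  have "\<exists>y s. y \<in> K \<and> \<psi> n y = ereal s \<and> (dist x y)\<^sup>2 / 2 - s < p n x + inverse (real (Suc n))" for n
  proof -
    have "c_transform (\<psi> n) x < ereal (p n x + inverse (real (Suc n)))"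
      by (simp add: p)
    then obtain y where y: "ereal ((dist x y)\<^sup>2 / 2) - \<psi> n y < ereal (p n x + inverse (real (Suc n)))"
      by (auto simp: c_transform_def INF_less_iff)
    with C[of n y] K(2)[of y n] show ?thesis
      by (cases "\<psi> n y"; cases "y \<in> K") auto
  qed
  then obtain y s where y: "\<And>n. y n \<in> K" "\<And>n. \<psi> n (y n) = ereal (s n)"
      "\<And>n. (dist x (y n))\<^sup>2 / 2 - s n < p n x + inverse (real (Suc n))"
    by metis
  obtain l r where l: "l \<in> K" "strict_mono (r :: nat \<Rightarrow> nat)" "(y \<circ> r) \<longlonglongrightarrow> l"
    using K(1) y(1) unfolding compact_def by blast
  have dist_lim: "(\<lambda>n. (dist z (y (r n)))\<^sup>2 / 2) \<longlonglongrightarrow> (dist z l)\<^sup>2 / 2" for z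
    using l(3) by (intro tendsto_intros) (auto simp: comp_def)
  have p_lim: "(\<lambda>n. p (r n) z) \<longlonglongrightarrow> q z" for z
    using LIMSEQ_subseq_LIMSEQ[OF lim l(2)] by (simp add: comp_def)
  have inv_lim: "(\<lambda>n. inverse (real (Suc (r n)))) \<longlonglongrightarrow> 0"
    using LIMSEQ_subseq_LIMSEQ[OF LIMSEQ_inverse_real_of_nat l(2)] by (simp add: comp_def)
  have low_lim: "(\<lambda>n. (dist x (y (r n)))\<^sup>2 / 2 - (p (r n) x + inverse (real (Suc (r n))))) \<longlonglongrightarrow> (dist x l)\<^sup>2 / 2 - (q x + 0)"
    by (intro tendsto_diff tendsto_add dist_lim p_lim inv_lim)
  have low: "(dist x (y n))\<^sup>2 / 2 - (p n x + inverse (real (Suc n))) \<le> s n" for n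
    using y(3)[of n] by simp
  \<comment> \<open>The values \<open>s n\<close> lie above the bound in \<open>low\<close> and
    below both \<open>C\<close> and \<open>(dist z (y n))\<^sup>2 / 2 - p n z\<close>. They are
    eliminated before passing to the limit, as they may fail to converge.\<close>
  have "ereal ((dist x l)\<^sup>2 / 2 - q x) \<le> limit_potential K C q l"
  proof (rule le_limit_potential[OF l(1)])
    have "s n \<le> C" for n using C[of n "y n"] y(2)[of n] by simp
    then show "(dist x l)\<^sup>2 / 2 - q x \<le> C"
      using low by (intro LIMSEQ_le_const2[OF low_lim[simplified]]) (auto intro: order_trans)
    fix z
    have "s n \<le> (dist z (y n))\<^sup>2 / 2 - p n z" for n
      using le_of_c_transform_eq[OF p[of n z], of "y n"] y(2)[of n] by simp
    then have "(dist x (y (r n)))\<^sup>2 / 2 - (p (r n) x + inverse (real (Suc (r n)))) \<le> (dist z (y (r n)))\<^sup>2 / 2 - p (r n) z" for n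
      using low by (rule order_trans[rotated])
    then show "(dist x l)\<^sup>2 / 2 - q x \<le> (dist l z)\<^sup>2 / 2 - q z"
      using LIMSEQ_le[OF low_lim tendsto_diff[OF dist_lim[of z] p_lim[of z]]] by (auto simp: dist_commute[of l z])
  qed
  then have "ereal ((dist x l)\<^sup>2 / 2) - limit_potential K C q l \<le> ereal (q x)"
    by (cases "limit_potential K C q l") auto
  then show "c_transform (limit_potential K C q) x \<le> ereal (q x)"
    unfolding c_transform_def by (rule INF_lower2[rotated]) simp
  show "ereal (q x) \<le> c_transform (limit_potential K C q) x"
    unfolding c_transform_def
  proof (rule INF_greatest)
    fix y
    show "ereal (q x) \<le> ereal ((dist x y)\<^sup>2 / 2) - limit_potential K C q y"
      using limit_potential_le_cost[of K C q y x]
      by (cases "limit_potential K C q y") (auto simp: dist_commute)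
  qed
qed

text \<open>Each \<open>x\<close> gives an upper bound for \<open>\<psi> n y\<close> that passes to
  the limit, after which the infimum over \<open>x\<close> is taken. Subtracting from
  \<open>C\<close> puts the resulting bound on the upper limit into the nonnegative form suited to
  Fatou's lemma.\<close>

lemma liminf_limit_potential:
  fixes p :: "nat \<Rightarrow> 'a::metric_space \<Rightarrow> real"
  assumes lim: "\<And>x. (\<lambda>n. p n x) \<longlonglongrightarrow> q x" and p: "\<And>n x. c_transform (\<psi> n) x = ereal (p n x)"
    and C: "\<And>n y. \<psi> n y \<le> ereal C" and "y \<in> K"
  shows "e2ennreal (ereal C - limit_potential K C q y) \<le> liminf (\<lambda>n. e2ennreal (ereal C - \<psi> n y))"
proof -
  define l where "l = liminf (\<lambda>n. e2ennreal (ereal C - \<psi> n y))"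
  have *: "ennreal (C - ((dist y x)\<^sup>2 / 2 - q x)) \<le> l" for x
  proof -
    have "ennreal (C - ((dist y x)\<^sup>2 / 2 - p n x)) \<le> e2ennreal (ereal C - \<psi> n y)" for n
    proof -
      have "\<psi> n y \<le> ereal ((dist y x)\<^sup>2 / 2 - p n x)"
        using le_of_c_transform_eq[OF p[of n x], of y] C[of n y] by (cases "\<psi> n y") (auto simp: dist_commute)
      then have "ereal (C - ((dist y x)\<^sup>2 / 2 - p n x)) \<le> ereal C - \<psi> n y"
        by (cases "\<psi> n y") auto
      from e2ennreal_mono[OF this] show ?thesis by simp
    qed
    then have "liminf (\<lambda>n. ennreal (C - ((dist y x)\<^sup>2 / 2 - p n x))) \<le> l"
      unfolding l_def by (intro Liminf_mono) auto
    moreover have "(\<lambda>n. ennreal (C - ((dist y x)\<^sup>2 / 2 - p n x))) \<longlonglongrightarrow> ennreal (C - ((dist y x)\<^sup>2 / 2 - q x))"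
      by (intro tendsto_intros lim)
    ultimately show ?thesis
      by (simp add: lim_imp_Liminf)
  qed
  have "e2ennreal (ereal C - limit_potential K C q y) \<le> l"
  \<comment> \<open>If the lower limit is a finite \<open>t\<close>, then \<open>C - t\<close> lies
    below all competitors in the limit potential, and below the cutoff \<open>C\<close> because
    \<open>t\<close> is nonnegative. An infinite lower limit leaves nothing to prove.\<close>
  proof (cases l)
    case (real t)
    have "ereal (C - t) \<le> limit_potential K C q y"
    proof (rule le_limit_potential)
      fix x
      from *[of x] real show "C - t \<le> (dist y x)\<^sup>2 / 2 - q x"
        by (cases "0 \<le> C - ((dist y x)\<^sup>2 / 2 - q x)") auto
    qed (use real \<open>y \<in> K\<close> in auto)
    then have "ereal C - limit_potential K C q y \<le> ereal t"
      by (cases "limit_potential K C q y") auto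
    from e2ennreal_mono[OF this] real show ?thesis by simp
  qed simp
  then show ?thesis by (simp add: l_def)
qed

subsection \<open>Stability of Kantorovich potentials\<close>

theorem lemma2p3:
  fixes \<mm> \<sigma> \<eta> :: "'a::{complete_space, second_countable_topology} measure"
    and \<eta>n :: "nat \<Rightarrow> 'a measure"
    and f :: "'a \<Rightarrow> ennreal" and fn :: "nat \<Rightarrow> 'a \<Rightarrow> ennreal"
    and \<phi>n \<psi>n :: "nat \<Rightarrow> 'a \<Rightarrow> ereal"
    and x\<^sub>0 :: 'a and C :: real
  assumes "sets \<mm> = sets borel"
    and "\<And>B. B \<in> sets borel \<Longrightarrow> bounded B \<Longrightarrow> emeasure \<mm> B < \<infinity>"
    and "measure_support \<mm> = UNIV"
    and "\<sigma> \<in> P2" and "\<eta> \<in> P2" and "\<And>n. \<eta>n n \<in> P2"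
    and "f \<in> borel_measurable \<mm>" and "\<eta> = density \<mm> f"
    and "\<And>n. fn n \<in> borel_measurable \<mm>" and "\<And>n. \<eta>n n = density \<mm> (fn n)"
    and "compact (measure_support \<sigma>)"
    and "AE x in \<mm>. (\<lambda>n. fn n x) \<longlonglongrightarrow> f x"
    and "(\<integral>\<^sup>+x. (SUP n. fn n x) * ennreal (1 + (dist x x\<^sub>0)\<^sup>2) \<partial>\<mm>) < \<infinity>"
    and "C > 0"
    and "\<And>n. kantorovich_potential (\<eta>n n) \<sigma> (\<phi>n n) (\<psi>n n)"
    and "\<And>n x. \<bar>\<phi>n n x\<bar> \<le> ereal (C * (1 + (dist x x\<^sub>0)\<^sup>2))"
    and "\<And>n x. x \<notin> measure_support \<sigma> \<Longrightarrow> \<psi>n n x = -\<infinity>"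
    and "\<And>n x. \<psi>n n x \<le> ereal C"
  shows "\<exists>r \<phi> \<psi>. strict_mono (r :: nat \<Rightarrow> nat) \<and>
           kantorovich_potential \<eta> \<sigma> \<phi> \<psi> \<and>
           (\<forall>x. (\<lambda>k. \<phi>n (r k) x) \<longlonglongrightarrow> \<phi> x) \<and>
           (\<forall>x. \<bar>\<phi> x\<bar> \<le> ereal (C * (1 + (dist x x\<^sub>0)\<^sup>2))) \<and>
           (\<forall>x. \<psi> x \<le> ereal C)"
proof -
  note M_sets = assms(1) and \<sigma>_P2 = assms(4) and \<eta>_P2 = assms(5) and \<eta>n_P2 = assms(6)
  note f[measurable] = assms(7) and \<eta> = assms(8) and fn[measurable] = assms(9) and \<eta>n = assms(10)
  note K = assms(11) and f_lim = assms(12) and dom = assms(13) and \<open>C > 0\<close>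
  note pot = assms(15) and \<phi>_bound = assms(16) and \<psi>_supp = assms(17) and \<psi>_le = assms(18)
  note [measurable_cong] = M_sets
  define K where "K = measure_support \<sigma>"
  have \<sigma>_sets[measurable_cong]: "sets \<sigma> = sets borel" and "prob_space \<sigma>"
    using \<sigma>_P2 by (auto simp: P2_def)
  then interpret \<sigma>: prob_space \<sigma> by simp
  have probs: "prob_space (density \<mm> f)" "prob_space (density \<mm> (fn n))" for n
    using \<eta>_P2 \<eta>n_P2[of n] by (auto simp: P2_def \<eta> \<eta>n)
  obtain R where R: "R > 0" "\<And>y. y \<in> K \<Longrightarrow> dist x\<^sub>0 y \<le> R"
  proof -
    have "bounded K" using K by (simp add: K_def compact_imp_bounded)
    then obtain e where "\<forall>y\<in>K. dist x\<^sub>0 y \<le> e" by (auto simp: bounded_any_center[of _ x\<^sub>0])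
    then show thesis by (intro that[of "max e 1"]) auto
  qed
  have pot': "\<phi>n n \<in> L1 (\<eta>n n)" "\<psi>n n \<in> L1 \<sigma>" "\<psi>n n \<in> borel_measurable borel"
    "dual_maximizer (\<eta>n n) \<sigma> (\<phi>n n) (\<psi>n n)" for n
    using pot[of n] unfolding kantorovich_potential_def by blast+

  \<comment> \<open>Local Lipschitz bounds and a pointwise convergent subsequence\<close>
  define p where "p n x = real_of_ereal (\<phi>n n x)" for n x
  have \<phi>n: "\<phi>n n x = ereal (p n x)" for n x
    using \<phi>_bound[of n x] by (cases "\<phi>n n x") (auto simp: p_def)
  have p_bound: "\<bar>p n x\<bar> \<le> C * (1 + (dist x x\<^sub>0)\<^sup>2)" for n x
    using \<phi>_bound[of n x] by (simp add: \<phi>n)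
  have p_c: "c_transform (\<psi>n n) x = ereal (p n x)" for n x
    using pot[of n] by (simp add: kantorovich_potential_def \<phi>n[symmetric])
  have p_le: "p n x \<le> p n y + dist x y * (dist x x\<^sub>0 + dist y x\<^sub>0 + 2 * R) / 2" for n x y
    using c_transform_le_add[where \<psi>="\<psi>n n" and K=K and z=x\<^sub>0 and R=R and x=x and x'=y] R(2) \<psi>_supp[of _ n]
    by (simp add: p_c K_def)
  have p_lip: "\<bar>p n x - p n y\<bar> \<le> dist x y * (dist x x\<^sub>0 + dist y x\<^sub>0 + 2 * R) / 2" for n x y
    using p_le[of n x y] p_le[of n y x]
    unfolding abs_le_iff dist_commute[of y x] add.commute[of "dist y x\<^sub>0"] by linarith
  have p_equi: "\<exists>d>0. \<forall>n y. dist y x < d \<longrightarrow> \<bar>p n y - p n x\<bar> < e" if "e > 0" for x e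
  proof -
    \<comment> \<open>\<open>L\<close> bounds the last factor in \<open>p_lip\<close> for all
      \<open>y\<close> within distance 1 of \<open>x\<close>; this is why the radius is cut at
      1.\<close>
    define L where "L = 2 * dist x x\<^sub>0 + 1 + 2 * R"
    have "L > 0" using R(1) by (auto simp: L_def intro: add_nonneg_pos)
    have "\<bar>p n y - p n x\<bar> < e" if "dist y x < min 1 (e / L)" for n y
    proof -
      have "dist y x\<^sub>0 \<le> dist x x\<^sub>0 + 1"
        using dist_triangle[of y x\<^sub>0 x] that by simp
      then have "dist y x * (dist y x\<^sub>0 + dist x x\<^sub>0 + 2 * R) \<le> dist y x * L"
        by (intro mult_left_mono) (auto simp: L_def)
      then have "\<bar>p n y - p n x\<bar> \<le> dist y x * L / 2"
        using p_lip[of n y x] by simp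
      also have "\<dots> \<le> dist y x * L"
        using \<open>L > 0\<close> by simp
      also have "\<dots> < e"
        using that \<open>L > 0\<close> by (simp add: field_simps)
      finally show ?thesis .
    qed
    then show ?thesis
      using \<open>e > 0\<close> \<open>L > 0\<close> by (intro exI[of _ "min 1 (e / L)"]) auto
  qed
  obtain r q where r: "strict_mono (r :: nat \<Rightarrow> nat)" and q: "\<And>x. (\<lambda>k. p (r k) x) \<longlonglongrightarrow> q x"
  proof (rule equicontinuous_pointwise_subsequence[of p "\<lambda>x. C * (1 + (dist x x\<^sub>0)\<^sup>2)"])
    show "C * (1 + (dist x x\<^sub>0)\<^sup>2) > 0" for x
      using \<open>C > 0\<close> by (auto intro!: mult_pos_pos add_pos_nonneg)
  qed (use p_bound p_equi in blast)+
  have q_bound: "\<bar>q x\<bar> \<le> C * (1 + (dist x x\<^sub>0)\<^sup>2)" for x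
    using p_bound by (intro LIMSEQ_le_const2[OF tendsto_rabs[OF q]]) auto

  \<comment> \<open>The limit pair and measurability\<close>
  define \<psi> where "\<psi> = limit_potential K C q"
  have \<psi>_c: "c_transform \<psi> x = ereal (q x)" for x
    unfolding \<psi>_def using q p_c \<psi>_le \<psi>_supp K
    by (intro c_transform_limit_potential[of "\<lambda>k. p (r k)" q "\<lambda>k. \<psi>n (r k)"]) (auto simp: K_def)
  have [measurable]: "\<psi> \<in> borel_measurable borel"
    unfolding \<psi>_def using K by (intro borel_measurable_limit_potential) (simp add: K_def compact_imp_closed)
  have [measurable]: "p n \<in> borel_measurable borel" for n
  proof -
    have "\<phi>n n \<in> borel_measurable (\<eta>n n)"
      using pot'(1)[of n] by (simp add: L1_def)
    moreover have "sets (\<eta>n n) = sets borel"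
      by (simp add: \<eta>n M_sets)
    ultimately have "\<phi>n n \<in> borel_measurable borel"
      by (simp cong: measurable_cong_sets)
    then show ?thesis
      unfolding p_def[abs_def] by measurable
  qed
  have [measurable]: "q \<in> borel_measurable borel"
    using q by (rule borel_measurable_LIMSEQ_real) measurable

  \<comment> \<open>The dominating density\<close>
  define F where "F x = (SUP n. fn n x)" for x
  define w where "w x = 1 + (dist x x\<^sub>0)\<^sup>2" for x
  have [measurable]: "F \<in> borel_measurable \<mm>" "w \<in> borel_measurable borel"
    unfolding F_def[abs_def] w_def[abs_def] by measurable
  have w_ge: "w x \<ge> 1" for x by (simp add: w_def)
  have dom': "(\<integral>\<^sup>+x. F x * ennreal (w x) \<partial>\<mm>) < \<infinity>"
    using dom by (simp add: F_def w_def)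
  have fn_le: "fn n x \<le> F x" for n x
    unfolding F_def by (rule SUP_upper) simp
  have F_fin: "AE x in \<mm>. F x < \<infinity>"
  proof -
    have "AE x in \<mm>. F x * ennreal (w x) \<noteq> \<infinity>"
      using dom' by (intro nn_integral_PInf_AE) auto
    then show ?thesis
    proof eventually_elim
      fix x assume "F x * ennreal (w x) \<noteq> \<infinity>"
      with w_ge[of x] show "F x < \<infinity>"
        by (auto simp: ennreal_mult_eq_top_iff less_top)
    qed
  qed
  have f_le: "AE x in \<mm>. f x \<le> F x"
    using f_lim by eventually_elim (auto intro: LIMSEQ_le_const2 fn_le)

  \<comment> \<open>A bound for the transport cost and the vanishing of the rerouting cost\<close>
  define a where "a x = ennreal (2 * R\<^sup>2 + 2) * ennreal (w x)" for x
  have [measurable]: "a \<in> borel_measurable borel"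
    unfolding a_def[abs_def] by measurable
  \<comment> \<open>Integrability makes \<open>\<psi>n 0\<close> finite almost everywhere, while it
    is \<open>-\<infinity>\<close> off the support; hence \<open>K\<close> has full measure.\<close>
  have AE_K: "AE y in \<sigma>. y \<in> K"
  proof -
    from AE_finite_L1[OF pot'(2)[of 0]] show ?thesis
    proof eventually_elim
      fix y assume "\<bar>\<psi>n 0 y\<bar> \<noteq> \<infinity>"
      then show "y \<in> K"
        using \<psi>_supp[of y 0] by (cases "y \<in> K") (auto simp: K_def)
    qed
  qed
  have a_le: "AE y in \<sigma>. \<forall>x. ennreal ((dist x y)\<^sup>2) \<le> a x"
    using AE_K
  proof eventually_elim
    fix y assume "y \<in> K"
    show "\<forall>x. ennreal ((dist x y)\<^sup>2) \<le> a x"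
    proof
      fix x
      have "dist x y \<le> dist x x\<^sub>0 + R"
        using dist_triangle[of x y x\<^sub>0] R(2)[OF \<open>y \<in> K\<close>] by simp
      then have "(dist x y)\<^sup>2 \<le> (dist x x\<^sub>0 + R)\<^sup>2"
        by (rule power_mono) simp
      also have "\<dots> \<le> 2 * (dist x x\<^sub>0)\<^sup>2 + 2 * R\<^sup>2"
        using sum_squares_bound[of "dist x x\<^sub>0" R] by (simp add: power2_sum)
      \<comment> \<open>The constant in \<open>a\<close> is chosen so that both terms fit below its
        product with \<open>1 + d^2\<close>.\<close>
      also have "\<dots> \<le> (2 * R\<^sup>2 + 2) * w x"
        by (simp add: w_def algebra_simps)
      finally have "ennreal ((dist x y)\<^sup>2) \<le> ennreal ((2 * R\<^sup>2 + 2) * w x)"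
        by (rule ennreal_leI)
      also have "\<dots> = a x"
        unfolding a_def using w_ge[of x] by (intro ennreal_mult) auto
      finally show "ennreal ((dist x y)\<^sup>2) \<le> a x" .
    qed
  qed
  have F_a: "(\<integral>\<^sup>+x. F x * a x \<partial>\<mm>) < \<infinity>"
  proof -
    have "(\<integral>\<^sup>+x. F x * a x \<partial>\<mm>) = ennreal (2 * R\<^sup>2 + 2) * (\<integral>\<^sup>+x. F x * ennreal (w x) \<partial>\<mm>)"
      by (subst nn_integral_cmult[symmetric]) (auto simp: a_def ac_simps)
    then show ?thesis
      using dom' by (simp add: ennreal_mult_less_top)
  qed
  have fin_a: "(\<integral>\<^sup>+x. g x * a x \<partial>\<mm>) < \<infinity>" if "AE x in \<mm>. g x \<le> F x" for g
  proof -
    have "(\<integral>\<^sup>+x. g x * a x \<partial>\<mm>) \<le> (\<integral>\<^sup>+x. F x * a x \<partial>\<mm>)"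
      using that by (intro nn_integral_mono_AE) (auto elim!: eventually_mono intro: mult_right_mono)
    then show ?thesis using F_a by simp
  qed
  \<comment> \<open>The extra cost from \<open>W2_perturbation\<close> along the subsequence; the
    truncated difference is at most \<open>F\<close>, which supplies the dominating
    function.\<close>
  define \<delta> where "\<delta> n = (\<integral>\<^sup>+x. a x * (f x - fn (r n) x) \<partial>\<mm>)" for n
  have \<delta>_fin: "\<delta> n < \<infinity>" for n
  proof -
    have "\<delta> n \<le> (\<integral>\<^sup>+x. f x * a x \<partial>\<mm>)"
      unfolding \<delta>_def by (intro nn_integral_mono) (auto simp: mult.commute intro: mult_left_mono)
    then show ?thesis using fin_a[OF f_le] by simp
  qed
  have f_lim_r: "AE x in \<mm>. (\<lambda>n. fn (r n) x) \<longlonglongrightarrow> f x"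
    using f_lim by eventually_elim (use LIMSEQ_subseq_LIMSEQ[OF _ r] in \<open>force simp: comp_def\<close>)
  have "\<delta> \<longlonglongrightarrow> (\<integral>\<^sup>+x. 0 \<partial>\<mm>)"
    unfolding \<delta>_def[abs_def]
  proof (rule nn_integral_dominated_convergence[where w = "\<lambda>x. F x * a x"])
    show "AE x in \<mm>. a x * (f x - fn (r j) x) \<le> F x * a x" for j
      using f_le
    proof eventually_elim
      fix x assume "f x \<le> F x"
      then have "f x - fn (r j) x \<le> F x"
        by (rule order_trans[OF diff_le_self_ennreal])
      from mult_left_mono[OF this, of "a x"] show "a x * (f x - fn (r j) x) \<le> F x * a x"
        by (simp add: mult.commute)
    qed
    show "AE x in \<mm>. (\<lambda>i. a x * (f x - fn (r i) x)) \<longlonglongrightarrow> 0"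
      using f_lim_r f_le F_fin
    proof eventually_elim
      fix x assume lim: "(\<lambda>n. fn (r n) x) \<longlonglongrightarrow> f x" and "f x \<le> F x" "F x < \<infinity>"
      \<comment> \<open>Finiteness is essential here, since otherwise the limit
        \<open>f x - f x\<close> would be \<open>top\<close>.\<close>
      then have "f x \<noteq> \<infinity>" by auto
      then have "(\<lambda>i. f x - fn (r i) x) \<longlonglongrightarrow> f x - f x"
        by (intro tendsto_diff_ennreal_general lim tendsto_const) simp
      moreover have "a x \<noteq> top" by (simp add: a_def ennreal_mult_eq_top_iff)
      ultimately have "(\<lambda>i. a x * (f x - fn (r i) x)) \<longlonglongrightarrow> a x * (f x - f x)"
        by (intro ennreal_tendsto_cmult) (auto simp: less_top)
      then show "(\<lambda>i. a x * (f x - fn (r i) x)) \<longlonglongrightarrow> 0"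
        using \<open>f x \<noteq> \<infinity>\<close> by simp
    qed
  qed (use F_a in measurable)
  then have \<delta>_lim: "(\<lambda>n. enn2real (\<delta> n)) \<longlonglongrightarrow> 0"
    using tendsto_enn2real[of \<delta> 0] by simp

  \<comment> \<open>Comparison of the transport costs, and the dual formula along the
    sequence\<close>
  have W2_le: "(W2 \<eta> \<sigma>)\<^sup>2 \<le> (W2 (\<eta>n (r n)) \<sigma>)\<^sup>2 + enn2real (\<delta> n)" for n
  proof -
    have "ennreal ((W2 \<eta> \<sigma>)\<^sup>2) \<le> ennreal ((W2 (\<eta>n (r n)) \<sigma>)\<^sup>2) + \<delta> n"
      unfolding \<eta> \<eta>n \<delta>_def using probs a_le fin_a f_le fn_le M_sets \<sigma>_sets
      by (intro W2_perturbation) (auto simp: \<sigma>.prob_space_axioms)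
    also have "\<dots> = ennreal ((W2 (\<eta>n (r n)) \<sigma>)\<^sup>2 + enn2real (\<delta> n))"
      using \<delta>_fin[of n] by (simp add: ennreal_plus)
    finally show ?thesis
      by (subst (asm) ennreal_le_iff) auto
  qed
  have W2_n: "(W2 (\<eta>n n) \<sigma>)\<^sup>2 / 2 = (\<integral>x. p n x \<partial>\<eta>n n) + (\<integral>y. real_of_ereal (\<psi>n n y) \<partial>\<sigma>)" for n
  proof -
    have "ereal (1 / 2 * (W2 (\<eta>n n) \<sigma>)\<^sup>2) = ereal (dual_value (\<eta>n n) \<sigma> (\<phi>n n, \<psi>n n))"
      using pot'(4)[of n] unfolding dual_maximizer_def by metis
    then show ?thesis
      by (simp add: dual_value_def \<phi>n)
  qed

  \<comment> \<open>Convergence of the integrals of the potentials\<close>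
  have int_lim: "(\<lambda>n. \<integral>x. p (r n) x \<partial>\<eta>n (r n)) \<longlonglongrightarrow> (\<integral>x. q x \<partial>\<eta>)"
  proof -
    have fin: "AE x in \<mm>. f x < \<infinity>" "AE x in \<mm>. fn n x < \<infinity>" for n
      using F_fin f_le fn_le[of n] by (auto elim!: eventually_rev_mp intro: le_less_trans)
    \<comment> \<open>Measure and integrand both vary with \<open>n\<close>; written against
      \<open>\<mm>\<close>, the products share one dominating function.\<close>
    have "(\<lambda>n. \<integral>x. enn2real (fn (r n) x) * p (r n) x \<partial>\<mm>) \<longlonglongrightarrow> (\<integral>x. enn2real (f x) * q x \<partial>\<mm>)"
    proof (rule integral_dominated_convergence[where w = "\<lambda>x. enn2real (F x) * (C * w x)"])
      show "integrable \<mm> (\<lambda>x. enn2real (F x) * (C * w x))"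
      proof (rule integrableI_bounded)
        have "ennreal (norm (enn2real (F x) * (C * w x))) \<le> ennreal C * (F x * ennreal (w x))" for x
        proof -
          have "ennreal (norm (enn2real (F x) * (C * w x))) = ennreal C * (ennreal (enn2real (F x)) * ennreal (w x))"
            using \<open>C > 0\<close> w_ge[of x] by (simp add: ennreal_mult[symmetric] abs_mult ac_simps)
          also have "\<dots> \<le> ennreal C * (F x * ennreal (w x))"
            by (intro mult_left_mono mult_right_mono) (cases "F x"; simp)+
          finally show ?thesis .
        qed
        then have "(\<integral>\<^sup>+x. ennreal (norm (enn2real (F x) * (C * w x))) \<partial>\<mm>) \<le> (\<integral>\<^sup>+x. ennreal C * (F x * ennreal (w x)) \<partial>\<mm>)"
          by (rule nn_integral_mono)
        also have "\<dots> < \<infinity>"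
          using dom' by (simp add: nn_integral_cmult ennreal_mult_less_top)
        finally show "(\<integral>\<^sup>+x. ennreal (norm (enn2real (F x) * (C * w x))) \<partial>\<mm>) < \<infinity>" .
      qed measurable
      show "AE x in \<mm>. (\<lambda>n. enn2real (fn (r n) x) * p (r n) x) \<longlonglongrightarrow> enn2real (f x) * q x"
        using f_lim_r fin(1)
      proof eventually_elim
        fix x assume "(\<lambda>n. fn (r n) x) \<longlonglongrightarrow> f x" "f x < \<infinity>"
        then have "(\<lambda>n. enn2real (fn (r n) x)) \<longlonglongrightarrow> enn2real (f x)"
          by (intro tendsto_enn2real) auto
        then show "(\<lambda>n. enn2real (fn (r n) x) * p (r n) x) \<longlonglongrightarrow> enn2real (f x) * q x"
          by (intro tendsto_mult q)
      qed
      show "AE x in \<mm>. norm (enn2real (fn (r n) x) * p (r n) x) \<le> enn2real (F x) * (C * w x)" for n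
        using F_fin
      proof eventually_elim
        fix x assume "F x < \<infinity>"
        then have "enn2real (fn (r n) x) \<le> enn2real (F x)"
          by (intro enn2real_mono fn_le) simp
        then show "norm (enn2real (fn (r n) x) * p (r n) x) \<le> enn2real (F x) * (C * w x)"
          using p_bound[of "r n" x] by (auto simp: abs_mult w_def intro!: mult_mono)
      qed
    qed measurable
    then show ?thesis
      using fin by (simp add: \<eta> \<eta>n integral_density_ennreal)
  qed

  \<comment> \<open>Optimality of the limit pair by Fatou's lemma\<close>
  define u where "u = C + (\<integral>x. q x \<partial>\<eta>) - (W2 \<eta> \<sigma>)\<^sup>2 / 2"
  \<comment> \<open>By \<open>W2_n\<close> and \<open>W2_le\<close>, \<open>un n\<close> bounds the
    integral of \<open>C - \<psi>n (r n)\<close>. Only the fixed number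
    \<open>W2 \<eta> \<sigma>\<close> occurs in it, so its limit is known without any limit of the
    costs along the sequence.\<close>
  define un where "un n = C + (\<integral>x. p (r n) x \<partial>\<eta>n (r n)) + enn2real (\<delta> n) / 2 - (W2 \<eta> \<sigma>)\<^sup>2 / 2" for n
  have un_lim: "un \<longlonglongrightarrow> u"
    unfolding un_def[abs_def] u_def using tendsto_divide[OF \<delta>_lim tendsto_const[of 2]]
    by (intro tendsto_diff tendsto_const tendsto_add[where b = 0, simplified] tendsto_add int_lim) simp_all
  note pot'(3)[measurable]
  have un_ge: "(\<integral>\<^sup>+y. e2ennreal (ereal C - \<psi>n (r n) y) \<partial>\<sigma>) \<le> ennreal (un n)" "0 \<le> un n" for n
  proof -
    have "C - (\<integral>y. real_of_ereal (\<psi>n (r n) y) \<partial>\<sigma>) \<le> un n"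
      using W2_le[of n] W2_n[of "r n"] by (simp add: un_def)
    then show "(\<integral>\<^sup>+y. e2ennreal (ereal C - \<psi>n (r n) y) \<partial>\<sigma>) \<le> ennreal (un n)" "0 \<le> un n"
      using nn_integral_const_minus_L1[OF \<sigma>.prob_space_axioms pot'(2) \<psi>_le, of "r n"] by (auto intro: ennreal_leI)
  qed
  \<comment> \<open>Excludes truncation in \<open>ennreal u\<close>, so that the bound by it can
    later be read as a real inequality.\<close>
  have "u \<ge> 0"
    using un_ge(2) by (intro LIMSEQ_le_const[OF un_lim]) auto
  have \<psi>_int: "(\<integral>\<^sup>+y. e2ennreal (ereal C - \<psi> y) \<partial>\<sigma>) \<le> ennreal u"
  proof -
    have "(\<integral>\<^sup>+y. e2ennreal (ereal C - \<psi> y) \<partial>\<sigma>) \<le> (\<integral>\<^sup>+y. liminf (\<lambda>n. e2ennreal (ereal C - \<psi>n (r n) y)) \<partial>\<sigma>)"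
    proof (rule nn_integral_mono_AE, use AE_K in eventually_elim)
      fix y assume "y \<in> K"
      then show "e2ennreal (ereal C - \<psi> y) \<le> liminf (\<lambda>n. e2ennreal (ereal C - \<psi>n (r n) y))"
        unfolding \<psi>_def using q p_c \<psi>_le by (intro liminf_limit_potential[where p = "\<lambda>n. p (r n)"])
    qed
    also have "\<dots> \<le> liminf (\<lambda>n. \<integral>\<^sup>+y. e2ennreal (ereal C - \<psi>n (r n) y) \<partial>\<sigma>)"
      by (rule nn_integral_liminf) measurable
    also have "\<dots> \<le> liminf (\<lambda>n. ennreal (un n))"
      using un_ge(1) by (intro Liminf_mono) auto
    also have "\<dots> = ennreal u"
      by (intro lim_imp_Liminf tendsto_ennrealI un_lim) simp
    finally show ?thesis .
  qed
  have \<psi>_le_C: "\<psi> y \<le> ereal C" for y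
    unfolding \<psi>_def by (rule limit_potential_le)
  have \<psi>_L1: "\<psi> \<in> L1 \<sigma>"
  proof (rule L1_bounded_aboveI)
    show "(\<integral>\<^sup>+y. e2ennreal (ereal C - \<psi> y) \<partial>\<sigma>) < \<infinity>"
      using \<psi>_int by (rule le_less_trans) simp
  qed (use \<psi>_le_C in \<open>auto intro: \<sigma>.finite_measure_axioms\<close>)
  \<comment> \<open>With \<open>\<psi>\<close> integrable, \<open>\<psi>_int\<close> says that
    \<open>C\<close> minus its integral is at most \<open>u\<close>; cancelling \<open>C\<close>
    leaves the lower bound on the dual value.\<close>
  have "W2 \<eta> \<sigma> ^ 2 / 2 \<le> (\<integral>x. q x \<partial>\<eta>) + (\<integral>y. real_of_ereal (\<psi> y) \<partial>\<sigma>)"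
    using \<psi>_int \<open>u \<ge> 0\<close> nn_integral_const_minus_L1[OF \<sigma>.prob_space_axioms \<psi>_L1 \<psi>_le_C]
    by (simp add: u_def)
  then have opt: "1 / 2 * (W2 \<eta> \<sigma>)\<^sup>2 \<le> dual_value \<eta> \<sigma> (\<lambda>x. ereal (q x), \<psi>)"
    by (simp add: dual_value_def)

  \<comment> \<open>Admissibility of the limit pair and conclusion\<close>
  have q_L1: "(\<lambda>x. ereal (q x)) \<in> L1 \<eta>"
  proof -
    have "(\<integral>\<^sup>+x. ennreal \<bar>q x\<bar> \<partial>\<eta>) = (\<integral>\<^sup>+x. f x * ennreal \<bar>q x\<bar> \<partial>\<mm>)"
      unfolding \<eta> by (subst nn_integral_density) auto
    also have "\<dots> \<le> (\<integral>\<^sup>+x. ennreal C * (F x * ennreal (w x)) \<partial>\<mm>)"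
    proof (rule nn_integral_mono_AE, use f_le in eventually_elim)
      fix x assume "f x \<le> F x"
      moreover have "ennreal \<bar>q x\<bar> \<le> ennreal C * ennreal (w x)"
        using q_bound[of x, folded w_def] \<open>C > 0\<close> w_ge[of x] by (simp add: ennreal_mult[symmetric] ennreal_leI)
      ultimately have "f x * ennreal \<bar>q x\<bar> \<le> F x * (ennreal C * ennreal (w x))"
        by (intro mult_mono) auto
      then show "f x * ennreal \<bar>q x\<bar> \<le> ennreal C * (F x * ennreal (w x))"
        by (simp add: ac_simps)
    qed
    also have "\<dots> < \<infinity>"
      using dom' by (simp add: nn_integral_cmult ennreal_mult_less_top)
    finally show ?thesis
      by (auto simp: L1_def \<eta>)
  qed
  have dual: "(\<lambda>x. ereal (q x), \<psi>) \<in> dual_pairs \<eta> \<sigma>"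
  proof -
    have "ereal (q x) + \<psi> y \<le> ereal ((dist x y)\<^sup>2 / 2)" for x y
      using limit_potential_le_cost[of K C q y x] unfolding \<psi>_def[symmetric]
      by (cases "\<psi> y") (auto simp: dist_commute)
    moreover have "\<psi> y \<noteq> \<infinity>" for y
      using \<psi>_le_C[of y] by auto
    ultimately show ?thesis
      using q_L1 \<psi>_L1 by (simp add: dual_pairs_def)
  qed
  have "(INF \<gamma>\<in>couplings \<eta> \<sigma>. transport_cost \<gamma>) < \<infinity>"
    using M_sets \<sigma>_sets probs(1) \<sigma>.prob_space_axioms a_le fin_a[OF f_le]
    by (intro INF_transport_cost_finite[where a = a]) (simp_all add: \<eta> nn_integral_density)
  then have "dual_maximizer \<eta> \<sigma> (\<lambda>x. ereal (q x)) \<psi>"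
    using dual opt M_sets \<sigma>_sets by (intro dual_maximizerI) (simp_all add: \<eta>)
  then have "kantorovich_potential \<eta> \<sigma> (\<lambda>x. ereal (q x)) \<psi>"
    using \<eta>_P2 \<sigma>_P2 q_L1 \<psi>_L1 \<psi>_c dual by (auto simp: kantorovich_potential_def dual_pairs_def)
  then show ?thesis
    using r q q_bound \<psi>_le_C
    by (intro exI[of _ r] exI[of _ "\<lambda>x. ereal (q x)"] exI[of _ \<psi>]) (auto simp: \<phi>n)
qed

end
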